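(* For all integers $n \geq 0$, the following congruences hold: (1) $\overline{p}(11(8n+5)) \equiv 0 \pmod{11}$; (2) $\overline{p}(13\cdot 2^6(8n+7)) \equiv 0 \pmod{13}$.
   Context: For a positive integer $n$, an overpartition of $n$ is a nonincreasing sequence of positive integers summing to $n$ in which the first occurrence of each distinct part may be overlined. $\overline{p}(n)$ denotes the number of overpartitions of $n$ (with $\overline{p}(0)=1$); equivalently, $\sum_{n\ge 0}\overline{p}(n)q^n = \prod_{k\ge 1}\frac{1+q^k}{1-q^k}$. *)

theory Defs
  imports Main "HOL-Library.Multiset"
begin

text \<open>An overpartition of n: a partition of n (a multiset of positive parts summing to n)
  together with the set of distinct parts whose first occurrence is overlined.\<close>
definition overpartitions :: "nat \<Rightarrow> (nat multiset \<times> nat set) set" where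
  "overpartitions n = {(M, S). (\<forall>x\<in>#M. 0 < x) \<and> sum_mset M = n \<and> S \<subseteq> set_mset M}"

definition overpartition_count :: "nat \<Rightarrow> nat" where
  "overpartition_count n = card (overpartitions n)"

end

theory Submission
  imports Defs "HOL-Computational_Algebra.Formal_Laurent_Series" "HOL-Number_Theory.Cong"
begin

text \<open>
  Write \<open>a = \<Sum> q\<^bsup>n\<^sup>2\<^esup>\<close> (over all integers \<open>n\<close>), \<open>b(q) = a(-q)\<close>, \<open>L = a\<^sup>4 - b\<^sup>4\<close> and
  \<open>\<lambda> = L / a\<^sup>4\<close>. By Gauss, the signed generating function of the overpartition numbers is
  \<open>1/a = a\<^bsup>p-1\<^esup> / a\<^sup>p\<close>, and \<open>a\<^sup>p\<close> is congruent to \<open>a(q\<^sup>p)\<close> modulo \<open>p\<close>, so the coefficients at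
  multiples of \<open>p\<close> of \<open>1/a\<close> are determined by those of \<open>a\<^bsup>p-1\<^esup>\<close>.

  The relations \<open>a\<^sup>2 + b\<^sup>2 = 2 a(q\<^sup>2)\<^sup>2\<close> and \<open>a b = b(q\<^sup>2)\<^sup>2\<close> of the arithmetic-geometric mean yield,
  by uniqueness of solutions of functional equations under \<open>q \<mapsto> q\<^sup>2\<close>, both
  \<open>q d\<lambda>/dq = \<lambda> (1 - \<lambda>) a\<^sup>4\<close> and the congruence \<open>a\<^bsup>2(p-1)\<^esup> H(\<lambda>) \<equiv> 1\<close> for the Hasse polynomial \<open>H\<close>.
  Multiplying \<open>a\<^bsup>p-1\<^esup>\<close> by a power of the latter turns it, up to \<open>p\<close>-th powers, into a polynomial in
  \<open>\<lambda>\<close> times the logarithmic derivative \<open>b\<^sup>4\<close> of \<open>\<lambda>\<close>; there a power \<open>\<lambda>\<^sup>i\<close> with \<open>i\<close> prime to \<open>p\<close> is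
  an exact derivative and contributes nothing. What remains is an explicit polynomial in \<open>a\<close> and \<open>L\<close>,
  which is dissected modulo 4 and 8 by \<open>a = a(q\<^sup>4) + y\<close> and \<open>L(q\<^sup>4) = y\<^sup>4\<close>, where the exponents of
  \<open>y\<close> are all 1 modulo 8.
\<close>

section \<open>Congruences and coefficient extraction\<close>

text \<open>\<open>fps_expand\<close> and \<open>fps_extract\<close> are the operators V and U of
  the theory of modular forms.\<close>

definition fps_expand :: "nat \<Rightarrow> int fps \<Rightarrow> int fps" where
  "fps_expand k f = f oo fps_X ^ k"

definition fps_extract :: "nat \<Rightarrow> int fps \<Rightarrow> int fps" where
  "fps_extract k f = Abs_fps (\<lambda>n. f $ (k * n))"

definition fcong :: "nat \<Rightarrow> int fps \<Rightarrow> int fps \<Rightarrow> bool" where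
  "fcong p f g \<longleftrightarrow> of_nat p dvd f - g"

lemma fps_expand_nth: "k > 0 \<Longrightarrow> fps_expand k f $ n = (if k dvd n then f $ (n div k) else 0)"
  unfolding fps_expand_def by (subst fps_nth_compose_X_power) simp_all

lemma fps_expand_nth_mult [simp]: "k > 0 \<Longrightarrow> fps_expand k f $ (k * n) = f $ n"
  by (simp add: fps_expand_nth)

lemma fps_expand_add: "fps_expand k (f + g) = fps_expand k f + fps_expand k g"
  by (simp add: fps_expand_def fps_compose_add_distrib)

lemma fps_expand_diff: "fps_expand k (f - g) = fps_expand k f - fps_expand k g"
  by (simp add: fps_expand_def fps_compose_sub_distrib)

lemma fps_expand_mult: "k > 0 \<Longrightarrow> fps_expand k (f * g) = fps_expand k f * fps_expand k g"
  unfolding fps_expand_def by (rule fps_compose_mult_distrib) simp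

lemma fps_expand_power: "k > 0 \<Longrightarrow> fps_expand k (f ^ n) = fps_expand k f ^ n"
  unfolding fps_expand_def by (rule fps_compose_power[symmetric]) simp

lemma fps_expand_numeral [simp]: "fps_expand k (numeral w) = numeral w"
  by (simp add: fps_expand_def numeral_fps_const)

lemma fps_expand_XD: "k > 0 \<Longrightarrow> fps_XD (fps_expand k f) = of_nat k * fps_expand k (fps_XD f)"
  by (rule fps_ext) (auto simp: fps_expand_nth fps_of_nat[symmetric] elim!: dvdE)

lemma fps_extract_nth [simp]: "fps_extract k f $ n = f $ (k * n)"
  by (simp add: fps_extract_def)

lemma fps_extract_diff: "fps_extract k (f - g) = fps_extract k f - fps_extract k g"
  by (rule fps_ext) simp

lemma fps_extract_of_int_mult: "fps_extract k (of_int c * f) = of_int c * fps_extract k f"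
  by (rule fps_ext) (simp add: fps_of_int[symmetric])

lemma fps_extract_sum: "fps_extract k (sum f S) = (\<Sum>i\<in>S. fps_extract k (f i))"
  by (rule fps_ext) (simp add: fps_sum_nth)

text \<open>Projection formula for U: in the Cauchy product at \<open>k * n\<close> only indices
  divisible by \<open>k\<close> survive in the expanded factor, and they form the Cauchy product at
  \<open>n\<close>.\<close>

lemma fps_extract_mult_expand:
  assumes "k > 0"
  shows "fps_extract k (f * fps_expand k g) = fps_extract k f * g"
proof (rule fps_ext)
  fix n
  have "fps_extract k (f * fps_expand k g) $ n = (fps_expand k g * f) $ (k * n)"
    by (simp add: mult.commute)
  also have "\<dots> = (\<Sum>i=0..k*n. fps_expand k g $ i * f $ (k * n - i))"
    by (rule fps_mult_nth)
  also have "\<dots> = (\<Sum>i\<in>(*) k ` {0..n}. fps_expand k g $ i * f $ (k * n - i))"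
    by (rule sum.mono_neutral_right) (use assms in \<open>auto simp: fps_expand_nth elim!: dvdE\<close>)
  also have "\<dots> = (\<Sum>i=0..n. g $ i * f $ (k * (n - i)))"
    by (subst sum.reindex) (use assms in \<open>auto simp: inj_on_def right_diff_distrib'\<close>)
  also have "\<dots> = (g * fps_extract k f) $ n"
    by (simp add: fps_mult_nth)
  finally show "fps_extract k (f * fps_expand k g) $ n = (fps_extract k f * g) $ n"
    by (simp add: mult.commute)
qed

section \<open>Congruences of power series modulo p\<close>

lemma of_nat_dvd_fps_iff: "of_nat p dvd (f :: int fps) \<longleftrightarrow> (\<forall>n. int p dvd f $ n)"
proof
  assume "of_nat p dvd f"
  then show "\<forall>n. int p dvd f $ n"
    by (auto simp: fps_of_nat[symmetric] elim!: dvdE)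
next
  assume "\<forall>n. int p dvd f $ n"
  then have "f = of_nat p * Abs_fps (\<lambda>n. f $ n div int p)"
    by (intro fps_ext) (simp add: fps_of_nat[symmetric])
  then show "of_nat p dvd f" by (metis dvd_triv_left)
qed

lemma fcong_nth_iff: "fcong p f g \<longleftrightarrow> (\<forall>n. int p dvd f $ n - g $ n)"
  by (simp add: fcong_def of_nat_dvd_fps_iff)

lemma fcong_refl [simp, intro]: "fcong p f f"
  by (simp add: fcong_def)

lemma fcong_sym: "fcong p f g \<Longrightarrow> fcong p g f"
  unfolding fcong_def by (metis dvd_minus_iff minus_diff_eq)

lemma fcong_trans [trans]: "fcong p f g \<Longrightarrow> fcong p g h \<Longrightarrow> fcong p f h"
  unfolding fcong_def using dvd_add[of "of_nat p" "f - g" "g - h"] by simp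

lemma fcong_add: "fcong p f g \<Longrightarrow> fcong p f' g' \<Longrightarrow> fcong p (f + f') (g + g')"
  unfolding fcong_def using dvd_add[of "of_nat p" "f - g" "f' - g'"] by (simp add: algebra_simps)

lemma fcong_diff: "fcong p f g \<Longrightarrow> fcong p f' g' \<Longrightarrow> fcong p (f - f') (g - g')"
  unfolding fcong_def using dvd_diff[of "of_nat p" "f - g" "f' - g'"] by (simp add: algebra_simps)

lemma fcong_mult: "fcong p f g \<Longrightarrow> fcong p f' g' \<Longrightarrow> fcong p (f * f') (g * g')"
proof -
  assume "fcong p f g" "fcong p f' g'"
  then have "of_nat p dvd (f - g) * f' + g * (f' - g')"
    unfolding fcong_def by simp
  also have "(f - g) * f' + g * (f' - g') = f * f' - g * g'"
    by (simp add: algebra_simps)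
  finally show ?thesis by (simp add: fcong_def)
qed

lemma fcong_power: "fcong p f g \<Longrightarrow> fcong p (f ^ n) (g ^ n)"
  by (induction n) (auto intro: fcong_mult)

lemma fcong_sum: "(\<And>i. i \<in> S \<Longrightarrow> fcong p (f i) (g i)) \<Longrightarrow> fcong p (sum f S) (sum g S)"
  unfolding fcong_def by (simp add: sum_subtractf[symmetric] dvd_sum)

lemma fcong_extract: "fcong p f g \<Longrightarrow> fcong p (fps_extract k f) (fps_extract k g)"
  by (simp add: fcong_nth_iff)

text \<open>Power series over a field form a domain: if \<open>i\<close> and \<open>j\<close> are
  the first indices where \<open>f\<close> and \<open>g\<close> do not vanish modulo
  \<open>p\<close>, the coefficient of \<open>f * g\<close> at \<open>i + j\<close> is
  \<open>f $ i * g $ j\<close> modulo \<open>p\<close>. An arbitrary witness \<open>n\<close> also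
  admits factors like \<open>theta_diff\<close>, whose constant term is 0.\<close>

lemma prime_dvd_fps_mult_cancel:
  fixes f g :: "int fps"
  assumes p: "prime p" and dvd: "of_nat p dvd f * g" and n: "\<not> int p dvd f $ n"
  shows "of_nat p dvd g"
proof (rule ccontr)
  assume "\<not> of_nat p dvd g"
  then obtain m0 where m0: "\<not> int p dvd g $ m0" by (auto simp: of_nat_dvd_fps_iff)
  define i where "i = (LEAST i. \<not> int p dvd f $ i)"
  define j where "j = (LEAST j. \<not> int p dvd g $ j)"
  have i: "\<not> int p dvd f $ i" unfolding i_def by (rule LeastI, rule n)
  have j: "\<not> int p dvd g $ j" unfolding j_def by (rule LeastI, rule m0)
  have i': "int p dvd f $ k" if "k < i" for k using that not_less_Least i_def by blast
  have j': "int p dvd g $ k" if "k < j" for k using that not_less_Least j_def by blast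
  have "int p dvd (f * g) $ (i + j)"
    using dvd by (simp add: of_nat_dvd_fps_iff)
  also have "(f * g) $ (i + j) = f $ i * g $ j + (\<Sum>k\<in>{0..i+j}-{i}. f $ k * g $ (i + j - k))"
    unfolding fps_mult_nth by (subst sum.remove[of _ i]) auto
  finally have *: "int p dvd f $ i * g $ j + (\<Sum>k\<in>{0..i+j}-{i}. f $ k * g $ (i + j - k))" .
  have "int p dvd (\<Sum>k\<in>{0..i+j}-{i}. f $ k * g $ (i + j - k))"
  proof (rule dvd_sum)
    fix k assume k: "k \<in> {0..i+j}-{i}"
    show "int p dvd f $ k * g $ (i + j - k)"
    proof (cases "k < i")
      case True
      then show ?thesis using i' by simp
    next
      case False
      then have "i + j - k < j" using k by auto
      then show ?thesis using j' by simp
    qed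
  qed
  with * have "int p dvd f $ i * g $ j" by (simp add: dvd_add_left_iff)
  with p i j show False by (simp add: prime_dvd_mult_iff)
qed

lemma fcong_mult_cancel:
  assumes "prime p" "\<not> int p dvd h $ n" "fcong p (h * f) (h * g)"
  shows "fcong p f g"
  using prime_dvd_fps_mult_cancel[OF assms(1), of h "f - g" n] assms(2,3)
  by (simp add: fcong_def right_diff_distrib)

section \<open>Frobenius and the derivation q d/dq modulo p\<close>

lemma prime_dvd_add_power_diff:
  fixes x y :: "'a::comm_ring_1"
  assumes p: "prime p"
  shows "of_nat p dvd (x + y) ^ p - x ^ p - y ^ p"
proof -
  have p0: "p > 0" using p prime_gt_0_nat by blast
  have "(x + y) ^ p = (\<Sum>k\<le>p. of_nat (p choose k) * x ^ k * y ^ (p - k))"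
    by (rule binomial_ring)
  also have "{..p} = insert 0 (insert p {0<..<p})" using p0 by auto
  also have "(\<Sum>k\<in>\<dots>. of_nat (p choose k) * x ^ k * y ^ (p - k)) =
      y ^ p + x ^ p + (\<Sum>k\<in>{0<..<p}. of_nat (p choose k) * x ^ k * y ^ (p - k))"
    using p0 by (simp add: add.assoc)
  finally have eq: "(x + y) ^ p - x ^ p - y ^ p = (\<Sum>k\<in>{0<..<p}. of_nat (p choose k) * x ^ k * y ^ (p - k))"
    by simp
  have "of_nat p dvd (of_nat (p choose k) :: 'a)" if "k \<in> {0<..<p}" for k
  proof -
    have "p dvd (p choose k)" using that p by (auto intro!: dvd_choose_prime)
    then show ?thesis by (auto elim!: dvdE)
  qed
  then show ?thesis unfolding eq by (auto intro!: dvd_sum simp: mult.assoc)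
qed

lemma prime_dvd_power_diff_self:
  fixes a :: int
  assumes p: "prime p"
  shows "int p dvd a ^ p - a"
proof -
  have nat: "int p dvd int b ^ p - int b" for b
  proof (induction b)
    case 0
    then show ?case using prime_gt_0_nat[OF p] by (simp add: zero_power)
  next
    case (Suc b)
    have "int p dvd ((int b + 1) ^ p - int b ^ p - 1 ^ p) + (int b ^ p - int b)"
      by (intro dvd_add Suc prime_dvd_add_power_diff p)
    then show ?case by (simp add: algebra_simps)
  qed
  define b where "b = nat (a mod int p)"
  have "[a = int b] (mod int p)" using prime_gt_0_nat[OF p] by (simp add: b_def cong_def)
  moreover have "[int b ^ p = int b] (mod int p)" using nat by (simp add: cong_iff_dvd_diff)
  ultimately have "[a ^ p = a] (mod int p)" by (meson cong_pow cong_sym cong_trans)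
  then show ?thesis by (simp add: cong_iff_dvd_diff)
qed

text \<open>Write \<open>f = X * g + c\<close>. Modulo \<open>p\<close> the p-th power is additive,
  so the index drops from \<open>n\<close> to \<open>n - p\<close> with \<open>g\<close> in place of
  \<open>f\<close>, and Fermat's little theorem settles \<open>c\<close>. Hence the induction keeps
  \<open>f\<close> arbitrary.\<close>

lemma fcong_frobenius:
  assumes p: "prime p"
  shows "fcong p (f ^ p) (fps_expand p f)"
proof -
  have p0: "p > 0" using p prime_gt_0_nat by blast
  have "int p dvd (f ^ p) $ n - fps_expand p f $ n" for n
  proof (induction n arbitrary: f rule: less_induct)
    case (less n)
    define g where "g = fps_shift 1 f"
    have f: "f = fps_X * g + fps_const (f $ 0)"
      by (rule fps_ext) (auto simp: g_def)
    have "of_nat p dvd (fps_X * g + fps_const (f $ 0)) ^ p - (fps_X * g) ^ p - fps_const (f $ 0) ^ p"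
      by (rule prime_dvd_add_power_diff[OF p])
    then have 1: "int p dvd (f ^ p) $ n - ((fps_X * g) ^ p) $ n - (fps_const (f $ 0) ^ p) $ n"
      unfolding f[symmetric] by (simp add: of_nat_dvd_fps_iff)
    show ?case
    proof (cases "n < p")
      case True
      have "((fps_X * g) ^ p) $ n = 0" using True by (simp add: power_mult_distrib fps_X_power_mult_nth)
      moreover have "int p dvd (fps_const (f $ 0) ^ p) $ n - fps_expand p f $ n"
        using True p0 prime_dvd_power_diff_self[OF p, of "f $ 0"] by (cases "n = 0") (auto simp: fps_expand_nth nat_dvd_not_less)
      ultimately show ?thesis using dvd_add[OF 1] by (metis diff_add_cancel add_diff_eq diff_zero)
    next
      case False
      have a: "((fps_X * g) ^ p) $ n = (g ^ p) $ (n - p)"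
        using False by (simp add: power_mult_distrib fps_X_power_mult_nth)
      have b: "(fps_const (f $ 0) ^ p) $ n = 0" using False p0 by simp
      have c: "fps_expand p f $ n = fps_expand p g $ (n - p)"
        using False p0 by (auto simp: fps_expand_nth g_def le_div_geq not_less[symmetric] dvd_minus_self Suc_diff_Suc)
      have "int p dvd (g ^ p) $ (n - p) - fps_expand p g $ (n - p)"
        by (rule less) (use False p0 in auto)
      then show ?thesis using dvd_add[OF 1, of "(g ^ p) $ (n - p) - fps_expand p g $ (n - p)"] a b c by simp
    qed
  qed
  then show ?thesis by (simp add: fcong_nth_iff)
qed

text \<open>By Frobenius a p-th power is a series in \<open>q^p\<close> modulo \<open>p\<close>, so
  it leaves U with its exponent removed. This is the main rule for computing with U.\<close>

lemma fcong_extract_mult_power: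
  assumes "prime p"
  shows "fcong p (fps_extract p (f * g ^ p)) (fps_extract p f * g)"
proof -
  have "fcong p (fps_extract p (f * g ^ p)) (fps_extract p (f * fps_expand p g))"
    by (intro fcong_extract fcong_mult fcong_frobenius assms fcong_refl)
  then show ?thesis using assms by (simp add: fps_extract_mult_expand prime_gt_0_nat)
qed

text \<open>U kills exact derivatives, because q d/dq multiplies the coefficient at
  \<open>p * n\<close> by \<open>p * n\<close>.\<close>

lemma fcong_extract_XD: "fcong p (fps_extract p (fps_XD f)) 0"
  by (simp add: fcong_nth_iff)

lemma fps_XD_mult: "fps_XD (f * g) = f * fps_XD g + fps_XD f * (g :: int fps)"
  by (simp add: fps_XD_def algebra_simps)

lemma fps_XD_diff: "fps_XD (f - g) = fps_XD f - fps_XD (g :: int fps)"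
  by (simp add: fps_XD_def algebra_simps)

lemma fps_XD_power: "fps_XD (f ^ n) = of_nat n * f ^ (n - 1) * fps_XD (f :: int fps)"
  by (simp add: fps_XD_def fps_deriv_power' algebra_simps)

lemma fps_XD_of_nat_mult: "fps_XD (of_nat n * f) = of_nat n * fps_XD (f :: int fps)"
  by (rule fps_ext) (simp add: fps_of_nat[symmetric])

text \<open>Writing \<open>f\<^sup>p = f(q\<^sup>p) + p s\<close>, apply \<open>q d/dq\<close> and divide by \<open>p\<close>.\<close>
lemma fcong_extract_power_XD:
  assumes p: "prime p"
  shows "fcong p (fps_extract p (f ^ (p - 1) * fps_XD f)) (fps_XD f)"
proof -
  have p0: "p > 0" using p prime_gt_0_nat by blast
  obtain s where s: "f ^ p - fps_expand p f = of_nat p * s"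
    using fcong_frobenius[OF p, of f] unfolding fcong_def by (elim dvdE)
  have "fps_XD (f ^ p - fps_expand p f) = of_nat p * (f ^ (p - 1) * fps_XD f - fps_expand p (fps_XD f))"
    by (simp add: fps_XD_diff fps_XD_power fps_expand_XD[OF p0] algebra_simps)
  moreover have "fps_XD (f ^ p - fps_expand p f) = of_nat p * fps_XD s"
    unfolding s by (simp add: fps_XD_of_nat_mult)
  ultimately have "f ^ (p - 1) * fps_XD f - fps_expand p (fps_XD f) = fps_XD s"
    using p0 by simp
  then have "fps_extract p (f ^ (p - 1) * fps_XD f - fps_expand p (fps_XD f)) = fps_extract p (fps_XD s)"
    by simp
  moreover have "fps_extract p (fps_expand p (fps_XD f)) = fps_XD f"
    using p0 by (intro fps_ext) (simp only: fps_extract_nth fps_expand_nth_mult)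
  ultimately show ?thesis
    using fcong_extract_XD[of p s] by (simp add: fps_extract_diff fcong_def)
qed

section \<open>Theta series and the arithmetic-geometric mean\<close>

definition sq_roots :: "nat \<Rightarrow> int set" where
  "sq_roots n = {x. x\<^sup>2 = int n}"

definition sq_pairs :: "nat \<Rightarrow> (int \<times> int) set" where
  "sq_pairs n = {(x, y). x\<^sup>2 + y\<^sup>2 = int n}"

text \<open>Counting roots among all integers, and not only naturals, gives every positive square
  the coefficient 2 and makes coefficients of products count lattice points.\<close>

definition theta :: "int fps" where
  "theta = Abs_fps (\<lambda>n. int (card (sq_roots n)))"

definition theta_alt :: "int fps" where
  "theta_alt = theta oo (- fps_X)"

lemma finite_sq_roots [simp, intro]: "finite (sq_roots n)"
proof (rule finite_subset)
  show "sq_roots n \<subseteq> {- int n..int n}"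
  proof
    fix x assume "x \<in> sq_roots n"
    then have "\<bar>x\<bar>\<^sup>2 = int n" by (simp add: sq_roots_def)
    moreover have "\<bar>x\<bar> \<le> \<bar>x\<bar>\<^sup>2" using self_le_power[of "\<bar>x\<bar>" 2] by (cases "x = 0") auto
    ultimately show "x \<in> {- int n..int n}" by auto
  qed
qed auto

lemma sq_pairs_conv_UNION: "sq_pairs n = (\<Union>i\<in>{0..n}. sq_roots i \<times> sq_roots (n - i))"
proof (intro equalityI subsetI)
  fix z assume "z \<in> sq_pairs n"
  then obtain x y where z: "z = (x, y)" "x\<^sup>2 + y\<^sup>2 = int n" by (auto simp: sq_pairs_def)
  have "nat (x\<^sup>2) \<le> n" using z(2) zero_le_power2[of y] by linarith
  moreover have "x \<in> sq_roots (nat (x\<^sup>2))" by (simp add: sq_roots_def)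
  moreover have "y \<in> sq_roots (n - nat (x\<^sup>2))" using z(2) calculation(1) by (simp add: sq_roots_def of_nat_diff)
  ultimately show "z \<in> (\<Union>i\<in>{0..n}. sq_roots i \<times> sq_roots (n - i))" using z(1) by auto
qed (auto simp: sq_roots_def sq_pairs_def of_nat_diff)

lemma finite_sq_pairs [simp, intro]: "finite (sq_pairs n)"
  unfolding sq_pairs_conv_UNION by auto

text \<open>The weight serves two products at once: \<open>w = 1\<close> gives
  \<open>theta\<^sup>2\<close>, and the sign of the parity of \<open>y\<close> gives
  \<open>theta * theta_alt\<close>.\<close>

lemma theta_mult_weighted_nth:
  "(theta * Abs_fps (\<lambda>n. \<Sum>y\<in>sq_roots n. w y)) $ n = (\<Sum>(x, y)\<in>sq_pairs n. w y)"
proof -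
  have "(\<Sum>(x, y)\<in>sq_pairs n. w y) = (\<Sum>i\<in>{0..n}. \<Sum>(x, y)\<in>sq_roots i \<times> sq_roots (n - i). w y)"
    unfolding sq_pairs_conv_UNION
    by (rule sum.UNION_disjoint) (simp, simp, auto simp: sq_roots_def)
  also have "\<dots> = (\<Sum>i\<in>{0..n}. int (card (sq_roots i)) * (\<Sum>y\<in>sq_roots (n - i). w y))"
    by (intro sum.cong refl) (simp add: sum.cartesian_product[symmetric])
  finally show ?thesis by (simp add: fps_mult_nth theta_def)
qed

lemma theta_square_nth: "(theta\<^sup>2) $ n = int (card (sq_pairs n))"
  using theta_mult_weighted_nth[of "\<lambda>_. 1" n]
  by (simp add: theta_def power2_eq_square case_prod_unfold)

lemma fps_compose_neg_X_nth: "(f oo (- fps_X)) $ n = (-1) ^ n * (f :: int fps) $ n"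
  by (simp add: fps_compose_uminus')

lemma theta_alt_nth: "theta_alt $ n = (-1) ^ n * theta $ n"
  by (simp add: theta_alt_def fps_compose_neg_X_nth)

lemma theta_alt_compose_neg_X: "theta_alt oo (- fps_X) = theta"
  by (rule fps_ext) (simp add: fps_compose_neg_X_nth theta_alt_nth minus_one_mult_self flip: mult.assoc)

lemma even_root_iff: "y \<in> sq_roots n \<Longrightarrow> even y \<longleftrightarrow> even n"
  using even_power[of y 2] by (auto simp: sq_roots_def)

lemma theta_alt_conv_weighted:
  "theta_alt = Abs_fps (\<lambda>n. \<Sum>y\<in>sq_roots n. if even y then 1 else -1)"
proof (rule fps_ext)
  fix n
  have "(\<Sum>y\<in>sq_roots n. if even y then 1 else -1 :: int) = (\<Sum>y\<in>sq_roots n. (-1) ^ n)"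
    by (intro sum.cong refl) (simp add: even_root_iff)
  then show "theta_alt $ n = Abs_fps (\<lambda>n. \<Sum>y\<in>sq_roots n. if even y then 1 else -1) $ n"
    by (simp add: theta_alt_nth theta_def)
qed

text \<open>Up to the order of coordinates this multiplies the Gaussian integer
  \<open>u + i v\<close> by \<open>1 + i\<close>, of norm 2. It is onto because \<open>x\<close> and
  \<open>y\<close> have equal parity when \<open>x\<^sup>2 + y\<^sup>2\<close> is even.\<close>

lemma bij_betw_sq_pairs_double:
  "bij_betw (\<lambda>(u, v). (u + v, u - v)) (sq_pairs n) (sq_pairs (2 * n))"
proof (rule bij_betw_imageI)
  show "inj_on (\<lambda>(u, v). (u + v, u - v)) (sq_pairs n)"
    by (auto simp: inj_on_def)
  show "(\<lambda>(u, v). (u + v, u - v)) ` sq_pairs n = sq_pairs (2 * n)"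
  proof (intro equalityI subsetI)
    fix z assume "z \<in> sq_pairs (2 * n)"
    then obtain x y where z: "z = (x, y)" "x\<^sup>2 + y\<^sup>2 = 2 * int n" by (auto simp: sq_pairs_def)
    then have "even (x\<^sup>2 + y\<^sup>2)" by simp
    then have ev: "even (x + y)" by simp
    then obtain u where u: "x + y = 2 * u" by (elim evenE)
    define v where "v = x - u"
    have xy: "x = u + v" "y = u - v" using u by (auto simp: v_def)
    have "2 * (u\<^sup>2 + v\<^sup>2) = 2 * int n" using z(2) unfolding xy by (simp add: power2_eq_square algebra_simps)
    then have "(u, v) \<in> sq_pairs n" by (simp add: sq_pairs_def)
    then show "z \<in> (\<lambda>(u, v). (u + v, u - v)) ` sq_pairs n" using z(1) xy by force
  qed (auto simp: sq_pairs_def power2_eq_square algebra_simps)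
qed

text \<open>Odd coefficients cancel and even ones double; doubling \<open>m\<close> does not change
  the number of representations as a sum of two squares.\<close>

lemma theta_square_add: "theta\<^sup>2 + theta_alt\<^sup>2 = 2 * fps_expand 2 (theta\<^sup>2)"
proof (rule fps_ext)
  fix n
  have alt: "theta_alt\<^sup>2 = theta\<^sup>2 oo (- fps_X)"
    by (simp add: theta_alt_def fps_compose_power)
  show "(theta\<^sup>2 + theta_alt\<^sup>2) $ n = (2 * fps_expand 2 (theta\<^sup>2)) $ n"
  proof (cases "even n")
    case True
    then obtain m where m: "n = 2 * m" by (elim evenE)
    have "card (sq_pairs (2 * m)) = card (sq_pairs m)"
      using bij_betw_same_card[OF bij_betw_sq_pairs_double] by simp
    then show ?thesis
      by (simp add: m alt fps_compose_neg_X_nth theta_square_nth numeral_fps_const)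
  next
    case False
    then show ?thesis
      by (simp add: alt fps_compose_neg_X_nth fps_expand_nth numeral_fps_const)
  qed
qed

text \<open>The product is invariant under \<open>q |-> -q\<close>, so it has no odd coefficients.
  At even indices the rotation turns the sign of \<open>y\<close> into that of \<open>u - v\<close>,
  which depends only on \<open>m = u\<^sup>2 + v\<^sup>2\<close>.\<close>

lemma theta_mult_theta_alt: "theta * theta_alt = fps_expand 2 (theta_alt\<^sup>2)"
proof (rule fps_ext)
  fix n
  have sym: "(theta * theta_alt) oo (- fps_X) = theta * theta_alt"
    by (subst fps_compose_mult_distrib) (simp_all add: theta_alt_compose_neg_X mult.commute flip: theta_alt_def)
  show "(theta * theta_alt) $ n = fps_expand 2 (theta_alt\<^sup>2) $ n"
  proof (cases "even n")
    case True
    then obtain m where m: "n = 2 * m" by (elim evenE)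
    have "(theta * theta_alt) $ n = (\<Sum>(x, y)\<in>sq_pairs n. if even y then 1 else -1)"
      unfolding theta_alt_conv_weighted by (rule theta_mult_weighted_nth)
    also have "\<dots> = (\<Sum>(u, v)\<in>sq_pairs m. if even (u - v) then 1 else -1)"
      unfolding m by (rule sum.reindex_bij_betw[OF bij_betw_sq_pairs_double, symmetric, THEN trans])
        (simp add: case_prod_unfold)
    also have "\<dots> = (\<Sum>(u, v)\<in>sq_pairs m. (-1) ^ m)"
    proof (intro sum.cong refl, clarify)
      fix u v assume "(u, v) \<in> sq_pairs m"
      then have "int m = u\<^sup>2 + v\<^sup>2" by (simp add: sq_pairs_def)
      then have "even m \<longleftrightarrow> even (u - v)" by (metis even_add even_diff even_of_nat even_power pos2)
      then show "(if even (u - v) then 1 else -1 :: int) = (-1) ^ m" by simp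
    qed
    also have "\<dots> = (-1) ^ m * (theta\<^sup>2) $ m"
      by (simp add: theta_square_nth case_prod_unfold)
    also have "\<dots> = (theta_alt\<^sup>2) $ m"
      by (simp add: theta_alt_def fps_compose_power fps_compose_neg_X_nth)
    finally show ?thesis by (simp add: m)
  next
    case False
    have "(theta * theta_alt) $ n = - (theta * theta_alt) $ n"
      using arg_cong[OF sym, of "\<lambda>f. f $ n"] False by (simp only: fps_compose_neg_X_nth) simp
    then show ?thesis using False by (simp add: fps_expand_nth)
  qed
qed

lemma sq_roots_even:
  assumes "even n"
  shows "sq_roots n = (if 4 dvd n then (*) 2 ` sq_roots (n div 4) else {})"
proof -
  have *: "4 dvd n \<and> x \<in> (*) 2 ` sq_roots (n div 4)" if x: "x \<in> sq_roots n" for x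
  proof -
    obtain z where z: "x = 2 * z" using even_root_iff[OF x] assms by (auto elim: evenE)
    have "int n = 4 * z\<^sup>2" using x by (simp add: sq_roots_def z power2_eq_square)
    then have n: "n = 4 * nat (z\<^sup>2)" by simp
    then show ?thesis using z by (auto simp: sq_roots_def)
  qed
  show ?thesis
  proof (cases "4 dvd n")
    case True
    then obtain m where "n = 4 * m" by (elim dvdE)
    then have "(*) 2 ` sq_roots (n div 4) \<subseteq> sq_roots n" by (auto simp: sq_roots_def power2_eq_square)
    then show ?thesis using * True by auto
  qed (use * in auto)
qed

lemma theta_nth_even: "even n \<Longrightarrow> theta $ n = fps_expand 4 theta $ n"
  by (simp add: theta_def sq_roots_even fps_expand_nth card_image inj_on_def)

lemma theta_add: "theta + theta_alt = 2 * fps_expand 4 theta"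
proof (rule fps_ext)
  fix n
  show "(theta + theta_alt) $ n = (2 * fps_expand 4 theta) $ n"
  proof (cases "even n")
    case True
    then show ?thesis by (simp add: theta_alt_nth theta_nth_even numeral_fps_const)
  next
    case False
    then have "\<not> 4 dvd n" by (meson dvd_trans even_numeral)
    then show ?thesis using False by (simp add: theta_alt_nth fps_expand_nth numeral_fps_const)
  qed
qed

lemma theta_nth_0 [simp]: "theta $ 0 = 1"
  by (simp add: theta_def sq_roots_def)

lemma theta_nth_1 [simp]: "theta $ Suc 0 = 2"
proof -
  have "sq_roots 1 = {1, -1}" by (auto simp: sq_roots_def power2_eq_1_iff)
  then show ?thesis by (simp add: theta_def)
qed

lemma theta_alt_nth_0 [simp]: "theta_alt $ 0 = 1" "theta_alt $ Suc 0 = -2"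
  by (simp_all add: theta_alt_nth)

definition theta_odd :: "int fps" where
  "theta_odd = theta - fps_expand 4 theta"

text \<open>\<open>theta_odd\<close> collects the odd squares, and
  \<open>(2 * k + 1)\<^sup>2 = 4 * k * (k + 1) + 1\<close> with \<open>k * (k + 1)\<close>
  even.\<close>

lemma theta_odd_nth_eq_0:
  assumes "n mod 8 \<noteq> 1"
  shows "theta_odd $ n = 0"
proof (cases "even n")
  case True
  then show ?thesis by (simp add: theta_odd_def theta_nth_even)
next
  case False
  have "sq_roots n = {}"
  proof (rule ccontr)
    assume "sq_roots n \<noteq> {}"
    then obtain x where x: "x \<in> sq_roots n" by auto
    with False have "odd x" by (simp add: even_root_iff)
    then obtain k where "x = 2 * k + 1" by (elim oddE)
    then have "x\<^sup>2 = 4 * (k * (k + 1)) + 1" by (simp add: power2_eq_square algebra_simps)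
    moreover obtain j where "k * (k + 1) = 2 * j" by (metis evenE even_mult_iff even_plus_one_iff)
    ultimately have "x\<^sup>2 mod 8 = 1" by simp
    moreover have "x\<^sup>2 = int n" using x by (simp add: sq_roots_def)
    ultimately have "int n mod 8 = 1" by simp
    then have "n mod 8 = 1" by presburger
    with assms show False by simp
  qed
  moreover have "\<not> 4 dvd n" using False by (meson dvd_trans even_numeral)
  ultimately show ?thesis by (simp add: theta_odd_def theta_def fps_expand_nth)
qed

lemma theta_conv_parts:
  "theta = fps_expand 4 theta + theta_odd" "theta_alt = fps_expand 4 theta - theta_odd"
  using theta_add by (simp_all add: theta_odd_def algebra_simps)

text \<open>The difference \<open>M\<close> of the two sides satisfies the homogeneous equation
  \<open>8 a(q\<^sup>2) b(q\<^sup>2) M(q\<^sup>2) = (a\<^sup>2 - b\<^sup>2) M(q)\<close> with \<open>a\<^sup>2 - b\<^sup>2 = 8q + \<dots>\<close>,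
  which forces \<open>M\<close> to have order exactly 1 unless it vanishes.\<close>
lemma theta_wronskian:
  "4 * (theta_alt * fps_XD theta - theta * fps_XD theta_alt) = theta * theta_alt * (theta ^ 4 - theta_alt ^ 4)"
proof -
  define a b where "a = theta" and "b = theta_alt"
  define a2 b2 where "a2 = fps_expand 2 a" and "b2 = fps_expand 2 b"
  define W where "W = b * fps_XD a - a * fps_XD b"
  define N where "N = a * b * (a ^ 4 - b ^ 4)"
  define M where "M = 4 * W - N"
  have r1: "2 * a2\<^sup>2 = a\<^sup>2 + b\<^sup>2" using theta_square_add by (simp add: a2_def a_def b_def fps_expand_power)
  have r2: "b2\<^sup>2 = a * b" using theta_mult_theta_alt by (simp add: b2_def a_def b_def fps_expand_power)
  have D2: "fps_XD (2 * f) = 2 * fps_XD f" for f :: "int fps"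
    using fps_XD_of_nat_mult[of 2 f] by simp
  have r1': "4 * (a2 * fps_XD a2) = 2 * (a * fps_XD a + b * fps_XD b)"
    using arg_cong[OF r1, of fps_XD] by (simp add: D2 fps_XD_power algebra_simps)
  have r2': "2 * (b2 * fps_XD b2) = a * fps_XD b + b * fps_XD a"
    using arg_cong[OF r2, of fps_XD] by (simp add: fps_XD_power fps_XD_mult algebra_simps)
  have XD2: "fps_XD a2 = 2 * fps_expand 2 (fps_XD a)" "fps_XD b2 = 2 * fps_expand 2 (fps_XD b)"
    by (simp_all add: a2_def b2_def fps_expand_XD)
  have VW: "2 * fps_expand 2 W = b2 * fps_XD a2 - a2 * fps_XD b2"
    by (simp add: W_def fps_expand_diff fps_expand_mult XD2 flip: a2_def b2_def)
  \<comment> \<open>The relations \<open>r1\<close>, \<open>r2\<close> and their derivatives express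
    the Wronskian of \<open>a2\<close> and \<open>b2\<close> through that of \<open>a\<close> and
    \<open>b\<close>.\<close>
  have "8 * a2 * b2 * fps_expand 2 W = 4 * a2 * b2 * (b2 * fps_XD a2 - a2 * fps_XD b2)"
    by (simp flip: VW)
  also have "\<dots> = b2\<^sup>2 * (4 * (a2 * fps_XD a2)) - 2 * a2\<^sup>2 * (2 * (b2 * fps_XD b2))"
    by (simp add: algebra_simps power2_eq_square)
  also have "\<dots> = (a\<^sup>2 - b\<^sup>2) * W"
    unfolding r1 r2 r1' r2' W_def by (simp add: algebra_simps power2_eq_square)
  finally have W: "8 * a2 * b2 * fps_expand 2 W = (a\<^sup>2 - b\<^sup>2) * W" .
  have "8 * a2 * b2 * fps_expand 2 N = 2 * a2\<^sup>2 * b2\<^sup>2 * ((2 * a2\<^sup>2)\<^sup>2 - 4 * (b2\<^sup>2)\<^sup>2)"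
    by (simp add: N_def fps_expand_diff fps_expand_mult fps_expand_power flip: a2_def b2_def)
      (simp add: algebra_simps power2_eq_square power4_eq_xxxx)
  also have "\<dots> = (a\<^sup>2 - b\<^sup>2) * N"
    unfolding r1 r2 N_def by (simp add: algebra_simps power2_eq_square power4_eq_xxxx)
  finally have N: "8 * a2 * b2 * fps_expand 2 N = (a\<^sup>2 - b\<^sup>2) * N" .
  have M: "8 * a2 * b2 * fps_expand 2 M = (a\<^sup>2 - b\<^sup>2) * M"
  proof -
    have "8 * a2 * b2 * fps_expand 2 M = 4 * (8 * a2 * b2 * fps_expand 2 W) - 8 * a2 * b2 * fps_expand 2 N"
      by (simp add: M_def fps_expand_diff fps_expand_mult algebra_simps)
    then show ?thesis unfolding W N M_def by (simp add: algebra_simps)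
  qed
  \<comment> \<open>Both \<open>4 * W\<close> and \<open>N\<close> begin with
    \<open>16 q\<close>.\<close>
  have M01: "M $ 0 = 0" "M $ Suc 0 = 0"
  proof -
    have ab: "a $ 0 = 1" "a $ Suc 0 = 2" "b $ 0 = 1" "b $ Suc 0 = -2" by (simp_all add: a_def b_def)
    have "a ^ 4 - b ^ 4 = (a - b) * ((a + b) * (a * a + b * b))"
      by (simp add: algebra_simps power4_eq_xxxx)
    then show "M $ 0 = 0" "M $ Suc 0 = 0"
      by (simp_all add: M_def W_def N_def ab numeral_fps_const del: power_Suc)
  qed
  have "M = 0"
  proof (rule ccontr)
    assume "M \<noteq> 0"
    define n where "n = subdegree M"
    have n: "M $ n \<noteq> 0" "\<And>k. k < n \<Longrightarrow> M $ k = 0"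
      using \<open>M \<noteq> 0\<close> by (simp_all add: n_def nth_less_subdegree_zero)
    then have "n \<ge> 2" using M01 by (metis One_nat_def less_2_cases not_less)
    \<comment> \<open>Compare coefficients at \<open>Suc n\<close>: the expanded series has order
      \<open>2 * n\<close>, which exceeds \<open>Suc n\<close>, while the other side contributes
      \<open>8 * M $ n\<close>.\<close>
    have "(8 * a2 * b2 * fps_expand 2 M) $ Suc n = 0"
      unfolding fps_mult_nth[of _ "fps_expand 2 M"]
    proof (intro sum.neutral ballI)
      fix i assume "i \<in> {0..Suc n}"
      have "(Suc n - i) div 2 < n" using \<open>n \<ge> 2\<close> by linarith
      then show "(8 * a2 * b2) $ i * fps_expand 2 M $ (Suc n - i) = 0"
        by (simp add: fps_expand_nth n(2))
    qed
    moreover have "((a\<^sup>2 - b\<^sup>2) * M) $ Suc n = (a\<^sup>2 - b\<^sup>2) $ Suc 0 * M $ n"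
    proof -
      have "((a\<^sup>2 - b\<^sup>2) * M) $ Suc n = (\<Sum>i\<in>{0..Suc n}. (a\<^sup>2 - b\<^sup>2) $ i * M $ (Suc n - i))"
        by (rule fps_mult_nth)
      also have "\<dots> = (\<Sum>i\<in>{Suc 0}. (a\<^sup>2 - b\<^sup>2) $ i * M $ (Suc n - i))"
      proof (rule sum.mono_neutral_right)
        show "\<forall>i\<in>{0..Suc n} - {Suc 0}. (a\<^sup>2 - b\<^sup>2) $ i * M $ (Suc n - i) = 0"
        proof
          fix i assume i: "i \<in> {0..Suc n} - {Suc 0}"
          show "(a\<^sup>2 - b\<^sup>2) $ i * M $ (Suc n - i) = 0"
          proof (cases "i = 0")
            case True
            then show ?thesis by (simp add: a_def b_def power2_eq_square)
          next
            case False
            then have "Suc n - i < n" using i \<open>n \<ge> 2\<close> by auto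
            then show ?thesis by (simp add: n(2))
          qed
        qed
      qed auto
      finally show ?thesis by simp
    qed
    ultimately show False using M n(1) by (simp add: power2_eq_square a_def b_def)
  qed
  then show ?thesis by (simp add: M_def N_def W_def a_def b_def)
qed

section \<open>Coefficients at multiples of a prime\<close>

definition theta_diff :: "int fps" where
  "theta_diff = theta ^ 4 - theta_alt ^ 4"

text \<open>With denominators cleared, this says that the logarithmic derivative of
  \<open>L / A\<close> is \<open>B\<close>, where \<open>A = theta ^ 4\<close>,
  \<open>B = theta_alt ^ 4\<close> and \<open>L = A - B\<close>.\<close>

lemma theta_diff_XD:
  "theta ^ 4 * fps_XD theta_diff - theta_diff * fps_XD (theta ^ 4) = theta ^ 4 * theta_alt ^ 4 * theta_diff"
proof -
  have XD4: "fps_XD (f ^ 4) = 4 * f ^ 3 * fps_XD f" for f :: "int fps"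
    using fps_XD_power[of f 4] by simp
  have "theta ^ 4 * fps_XD theta_diff - theta_diff * fps_XD (theta ^ 4) =
      theta ^ 3 * theta_alt ^ 3 * (4 * (theta_alt * fps_XD theta - theta * fps_XD theta_alt))"
    unfolding theta_diff_def fps_XD_diff XD4 by (simp add: algebra_simps power4_eq_xxxx power3_eq_cube)
  also have "\<dots> = theta ^ 4 * theta_alt ^ 4 * theta_diff"
    unfolding theta_wronskian theta_diff_def by (simp add: algebra_simps power4_eq_xxxx power3_eq_cube)
  finally show ?thesis .
qed

lemma theta_diff_nth [simp]: "theta_diff $ 0 = 0" "theta_diff $ Suc 0 = 16"
proof -
  have *: "theta_diff = (theta - theta_alt) * ((theta + theta_alt) * (theta * theta + theta_alt * theta_alt))"
    by (simp add: theta_diff_def algebra_simps power4_eq_xxxx)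
  show "theta_diff $ 0 = 0" "theta_diff $ Suc 0 = 16" unfolding * by simp_all
qed

lemma prime_not_dvd_16: "prime p \<Longrightarrow> p \<noteq> 2 \<Longrightarrow> \<not> int p dvd 16"
proof
  assume p: "prime p" "p \<noteq> 2" "int p dvd 16"
  then have "int p dvd 2 ^ 4" by simp
  then have "int p dvd 2" using p(1) prime_dvd_power by (metis prime_nat_int_transfer)
  then show False using p primes_dvd_imp_eq[of p 2] by (metis int_dvd_int_iff of_nat_numeral two_is_prime_nat)
qed

text \<open>Logarithmic derivatives are fixed by U modulo \<open>p\<close>, as in the theory of the
  Cartier operator. Multiplying \<open>B\<close> by the p-th power of \<open>A * L\<close> clears
  the denominators of the logarithmic derivative, and \<open>fcong_extract_power_XD\<close> then
  applies to \<open>L\<close> and to \<open>A\<close>.\<close>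

lemma fcong_extract_theta_alt_4:
  assumes p: "prime p" "p \<noteq> 2"
  shows "fcong p (fps_extract p (theta_alt ^ 4)) (theta_alt ^ 4)"
proof -
  define A B L where "A = theta ^ 4" and "B = theta_alt ^ 4" and "L = theta_diff"
  have p0: "p > 0" using p prime_gt_0_nat by blast
  have pow: "f ^ p = f * f ^ (p - 1)" for f :: "int fps" using p0 by (cases p) simp_all
  have ABL: "A * fps_XD L - L * fps_XD A = A * B * L"
    using theta_diff_XD by (simp add: A_def B_def L_def)
  have "B * (A * L) ^ p = A ^ (p - 1) * L ^ (p - 1) * (A * B * L)"
    by (simp add: power_mult_distrib pow algebra_simps)
  also have "\<dots> = L ^ (p - 1) * fps_XD L * A ^ p - A ^ (p - 1) * fps_XD A * L ^ p"
    unfolding ABL[symmetric] by (simp add: pow algebra_simps)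
  finally have eq: "B * (A * L) ^ p = L ^ (p - 1) * fps_XD L * A ^ p - A ^ (p - 1) * fps_XD A * L ^ p" .
  have "fcong p (A * L * fps_extract p B) (fps_extract p (B * (A * L) ^ p))"
    using fcong_extract_mult_power[OF p(1), of B "A * L"] by (simp add: mult.commute fcong_sym)
  also have "fps_extract p (B * (A * L) ^ p) =
      fps_extract p (L ^ (p - 1) * fps_XD L * A ^ p) - fps_extract p (A ^ (p - 1) * fps_XD A * L ^ p)"
    by (simp add: eq fps_extract_diff)
  also have "fcong p \<dots> (fps_extract p (L ^ (p - 1) * fps_XD L) * A - fps_extract p (A ^ (p - 1) * fps_XD A) * L)"
    by (intro fcong_diff fcong_extract_mult_power p)
  also have "fcong p \<dots> (fps_XD L * A - fps_XD A * L)"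
    by (intro fcong_diff fcong_mult fcong_extract_power_XD p fcong_refl)
  also have "fps_XD L * A - fps_XD A * L = A * L * B"
    using ABL by (simp add: algebra_simps)
  finally have "fcong p (A * L * fps_extract p B) (A * L * B)" .
  then show ?thesis unfolding B_def
  \<comment> \<open>\<open>A * L\<close> begins with \<open>16 q\<close>; this is where
    \<open>p\<close> must be odd.\<close>
  proof (rule fcong_mult_cancel[OF p(1), rotated])
    have "(A * L) $ Suc 0 = 16" by (simp add: A_def L_def fps_power_zeroth)
    then show "\<not> int p dvd (A * L) $ Suc 0" using prime_not_dvd_16[OF p] by simp
  qed
qed

text \<open>Differentiating \<open>L ^ i * A ^ k\<close> gives \<open>i\<close> times the monomial
  in question plus a multiple of \<open>i + k\<close>, hence of \<open>p\<close>. So the monomial is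
  an exact derivative modulo \<open>p\<close> after division by \<open>i\<close>.\<close>

lemma fcong_extract_monomial:
  assumes p: "prime p" and ik: "p dvd i + k" "\<not> p dvd i" "k > 0"
  shows "fcong p (fps_extract p (theta_diff ^ i * (theta ^ 4) ^ k * theta_alt ^ 4)) 0"
proof -
  define A B L where "A = theta ^ 4" and "B = theta_alt ^ 4" and "L = theta_diff"
  have ABL: "A * fps_XD L = L * fps_XD A + A * B * L"
    using theta_diff_XD by (simp add: A_def B_def L_def algebra_simps)
  obtain i' k' where ik': "i = Suc i'" "k = Suc k'" using ik by (metis dvd_0_right gr0_conv_Suc not_gr_zero)
  obtain c where c: "i + k = p * c" using ik by (elim dvdE)
  have XD: "fps_XD (L ^ i) = of_nat i * L ^ i' * fps_XD L" "fps_XD (A ^ k) = of_nat k * A ^ k' * fps_XD A"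
    by (simp_all only: fps_XD_power ik' diff_Suc_1)
  have "fps_XD (L ^ i * A ^ k) = of_nat i * L ^ i' * A ^ k' * (A * fps_XD L) + of_nat k * L ^ i * A ^ k' * fps_XD A"
    unfolding fps_XD_mult XD by (simp add: ik' algebra_simps)
  also have "\<dots> = of_nat i * (L ^ i * A ^ k * B) + of_nat (i + k) * (L ^ i * A ^ k' * fps_XD A)"
    unfolding ABL by (simp add: ik' algebra_simps)
  finally have eq: "fps_XD (L ^ i * A ^ k) = of_nat i * (L ^ i * A ^ k * B) + of_nat p * (of_nat c * (L ^ i * A ^ k' * fps_XD A))"
    by (simp add: c mult.assoc)
  have "fcong p (of_nat i * fps_extract p (L ^ i * A ^ k * B)) 0"
    unfolding fcong_nth_iff
  proof
    fix n
    have "int (p * n) * (L ^ i * A ^ k) $ (p * n) = int i * (L ^ i * A ^ k * B) $ (p * n) +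
        int p * (of_nat c * (L ^ i * A ^ k' * fps_XD A)) $ (p * n)"
      using arg_cong[OF eq, of "\<lambda>f. f $ (p * n)"] by (simp add: fps_of_nat[symmetric])
    then have "int i * (L ^ i * A ^ k * B) $ (p * n) =
        int p * (int n * (L ^ i * A ^ k) $ (p * n) - (of_nat c * (L ^ i * A ^ k' * fps_XD A)) $ (p * n))"
      by (simp add: algebra_simps)
    then show "int p dvd (of_nat i * fps_extract p (L ^ i * A ^ k * B)) $ n - 0 $ n"
      by (simp add: fps_of_nat[symmetric])
  qed
  then have "fcong p (of_nat i * fps_extract p (L ^ i * A ^ k * B)) (of_nat i * 0)" by simp
  moreover have "\<not> int p dvd (of_nat i :: int fps) $ 0"
    using ik(2) by (simp add: fps_of_nat[symmetric])
  ultimately show ?thesis unfolding A_def B_def L_def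
    using fcong_mult_cancel[OF p] by blast
qed

text \<open>\<open>x\<^sup>d P(y/x)\<close>, the natural form of a modular form of weight \<open>2d\<close> when
  \<open>x = \<theta>\<^sup>4\<close> and \<open>y/x = \<lambda>\<close>.\<close>
definition homogenize :: "nat \<Rightarrow> int poly \<Rightarrow> 'a::comm_ring_1 \<Rightarrow> 'a \<Rightarrow> 'a" where
  "homogenize d P x y = (\<Sum>i\<le>d. of_int (coeff P i) * y ^ i * x ^ (d - i))"

lemma homogenize_add: "homogenize d (P + Q) x y = homogenize d P x y + homogenize d Q x y"
  by (simp add: homogenize_def algebra_simps sum.distrib)

lemma homogenize_smult: "homogenize d (smult c P) x y = of_int c * homogenize d P x y"
  by (simp add: homogenize_def sum_distrib_left mult.assoc)

lemma homogenize_pCons: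
  "homogenize (Suc d) (pCons c P) x y = of_int c * x ^ Suc d + y * homogenize d P x y"
  unfolding homogenize_def sum.atMost_Suc_shift
  by (simp add: sum_distrib_left algebra_simps)

lemma homogenize_shift:
  assumes "degree P \<le> d"
  shows "homogenize (k + d) P x y = x ^ k * homogenize d P x y"
proof -
  have "homogenize (k + d) P x y = (\<Sum>i\<le>d. of_int (coeff P i) * y ^ i * x ^ (k + d - i))"
    unfolding homogenize_def
    by (rule sum.mono_neutral_right) (use assms in \<open>auto simp: coeff_eq_0\<close>)
  also have "\<dots> = x ^ k * homogenize d P x y"
    unfolding homogenize_def sum_distrib_left
  proof (intro sum.cong refl)
    fix i assume "i \<in> {..d}"
    then have "k + d - i = k + (d - i)" by simp
    then show "of_int (coeff P i) * y ^ i * x ^ (k + d - i) = x ^ k * (of_int (coeff P i) * y ^ i * x ^ (d - i))"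
      by (simp only: power_add mult_ac)
  qed
  finally show ?thesis .
qed

text \<open>Horner's scheme: splitting off the constant coefficient of \<open>P\<close> avoids
  convolutions, and \<open>homogenize_shift\<close> supplies the missing powers of
  \<open>x\<close>.\<close>

lemma homogenize_mult:
  assumes "degree P \<le> d" "degree Q \<le> e"
  shows "homogenize (d + e) (P * Q) x y = homogenize d P x y * homogenize e Q x y"
  using assms(1)
proof (induction d arbitrary: P)
  case 0
  then obtain c where "P = [:c:]" by (auto elim: degree_eq_zeroE)
  then show ?case by (simp add: homogenize_smult) (simp add: homogenize_def)
next
  case (Suc d)
  obtain c P' where P: "P = pCons c P'" by (cases P)
  have P': "degree P' \<le> d" using Suc.prems P by (cases "P' = 0") auto
  have "homogenize (Suc d + e) (P * Q) x y =
      homogenize (Suc d + e) (smult c Q) x y + homogenize (Suc (d + e)) (pCons 0 (P' * Q)) x y"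
    by (simp add: P homogenize_add)
  also have "\<dots> = of_int c * (x ^ Suc d * homogenize e Q x y) + y * (homogenize d P' x y * homogenize e Q x y)"
    by (simp only: homogenize_smult homogenize_shift[OF assms(2)] homogenize_pCons Suc.IH[OF P']) simp
  also have "\<dots> = homogenize (Suc d) P x y * homogenize e Q x y"
    by (simp add: P homogenize_pCons algebra_simps)
  finally show ?case .
qed

lemma homogenize_power:
  assumes "degree P \<le> d"
  shows "homogenize (n * d) (P ^ n) x y = homogenize d P x y ^ n"
proof (induction n)
  case 0
  then show ?case by (simp add: homogenize_def)
next
  case (Suc n)
  have "degree (P ^ n) \<le> n * d" using assms degree_power_le[of P n] mult_le_mono1[OF assms, of n]
    by (metis le_trans mult.commute)
  then show ?case using Suc assms by (simp add: homogenize_mult)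
qed

text \<open>Monomials with \<open>i\<close> prime to \<open>p\<close> vanish under U; those with
  \<open>i = p * j\<close> are a p-th power times the fixed series
  \<open>theta_alt ^ 4\<close>.\<close>

lemma fcong_extract_homogenize:
  assumes p: "prime p" "p \<noteq> 2"
  shows "fcong p (fps_extract p (homogenize (p * m) P (theta ^ 4) theta_diff * theta_alt ^ 4))
     ((\<Sum>j\<le>m. of_int (coeff P (p * j)) * theta_diff ^ j * (theta ^ 4) ^ (m - j)) * theta_alt ^ 4)"
proof -
  define A B L where "A = theta ^ 4" and "B = theta_alt ^ 4" and "L = theta_diff"
  define c where "c = (\<lambda>i. of_int (coeff P i) :: int fps)"
  have p0: "p > 0" using p prime_gt_0_nat by blast
  have "fps_extract p (homogenize (p * m) P A L * B) = (\<Sum>i\<le>p*m. c i * fps_extract p (L ^ i * A ^ (p * m - i) * B))"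
    by (simp add: homogenize_def sum_distrib_right fps_extract_sum fps_extract_of_int_mult mult.assoc c_def)
  also have "fcong p \<dots> (\<Sum>i\<le>p*m. c i * (if p dvd i then L ^ (i div p) * A ^ (m - i div p) * B else 0))"
  proof (intro fcong_sum fcong_mult fcong_refl)
    fix i assume i: "i \<in> {..p*m}"
    show "fcong p (fps_extract p (L ^ i * A ^ (p * m - i) * B))
      (if p dvd i then L ^ (i div p) * A ^ (m - i div p) * B else 0)"
    proof (cases "p dvd i")
      case True
      then obtain j where j: "i = p * j" by (elim dvdE)
      have "L ^ i * A ^ (p * m - i) * B = B * (L ^ j * A ^ (m - j)) ^ p"
      proof -
        have pm: "p * m - p * j = p * (m - j)" by (simp add: diff_mult_distrib2)
        have pow: "f ^ (p * k) = (f ^ k) ^ p" for f :: "int fps" and k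
          by (metis mult.commute power_mult)
        show ?thesis unfolding j pm pow by (simp add: power_mult_distrib mult_ac)
      qed
      then have "fcong p (fps_extract p (L ^ i * A ^ (p * m - i) * B)) (fps_extract p B * (L ^ j * A ^ (m - j)))"
        using fcong_extract_mult_power[OF p(1), of B "L ^ j * A ^ (m - j)"] by (simp only:)
      also have "fcong p \<dots> (B * (L ^ j * A ^ (m - j)))"
        unfolding B_def by (intro fcong_mult fcong_refl fcong_extract_theta_alt_4 p)
      finally show ?thesis using p0 by (simp add: j mult_ac)
    next
      case False
      \<comment> \<open>This makes the exponent of \<open>A\<close> positive, as
        \<open>fcong_extract_monomial\<close> requires.\<close>
      then have "i \<noteq> p * m" by auto
      then have "fcong p (fps_extract p (L ^ i * A ^ (p * m - i) * B)) 0"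
        unfolding A_def B_def L_def using i False by (intro fcong_extract_monomial p) auto
      then show ?thesis using False by simp
    qed
  qed
  also have "(\<Sum>i\<le>p*m. c i * (if p dvd i then L ^ (i div p) * A ^ (m - i div p) * B else 0)) =
      (\<Sum>i\<in>(*) p ` {..m}. c i * (if p dvd i then L ^ (i div p) * A ^ (m - i div p) * B else 0))"
    by (rule sum.mono_neutral_right) (use p0 in \<open>auto elim!: dvdE\<close>)
  also have "\<dots> = (\<Sum>j\<le>m. c (p * j) * (L ^ j * A ^ (m - j) * B))"
    by (subst sum.reindex) (use p0 in \<open>auto simp: inj_on_def\<close>)
  also have "\<dots> = (\<Sum>j\<le>m. c (p * j) * L ^ j * A ^ (m - j)) * B"
    by (simp add: sum_distrib_right mult.assoc)
  finally show ?thesis by (simp add: A_def B_def L_def c_def)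
qed

text \<open>A coefficient at an odd index vanishes modulo \<open>p\<close>, and one at an even index
  agrees with that at half the index, so descent leaves only the constant term.\<close>

lemma fcong_1_if_expand:
  assumes "fcong p (fps_expand 2 E) E" "int p dvd E $ 0 - 1"
  shows "fcong p E 1"
proof -
  have "int p dvd E $ n" if "n > 0" for n
    using that
  proof (induction n rule: less_induct)
    case (less n)
    have 1: "int p dvd fps_expand 2 E $ n - E $ n" using assms(1) by (simp add: fcong_nth_iff)
    have "int p dvd fps_expand 2 E $ n"
      using less by (auto simp: fps_expand_nth elim!: evenE)
    then show ?case using dvd_diff[OF _ 1] by fastforce
  qed
  then show ?thesis using assms(2) by (auto simp: fcong_nth_iff)
qed

section \<open>The Hasse polynomial\<close>

lemma homogenize_0_const: "homogenize 0 [:c:] x y = of_int c"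
  by (simp add: homogenize_def)

lemma homogenize_pCons_numeral:
  "homogenize (numeral w) (pCons c P) x y = of_int c * x ^ numeral w + y * homogenize (pred_numeral w) P x y"
  by (simp add: numeral_eq_Suc homogenize_pCons)

lemmas homogenize_simps = homogenize_0_const homogenize_pCons homogenize_pCons_numeral

lemma homogenize_scale: "homogenize d P (c * x) (c * y) = c ^ d * homogenize d P x y"
proof -
  have "of_int (coeff P i) * (c * y) ^ i * (c * x) ^ (d - i) = c ^ d * (of_int (coeff P i) * y ^ i * x ^ (d - i))"
    if "i \<le> d" for i
  proof -
    have "c ^ d = c ^ i * c ^ (d - i)" using that by (simp flip: power_add)
    then show ?thesis by (simp only: power_mult_distrib mult_ac)
  qed
  then show ?thesis by (simp add: homogenize_def sum_distrib_left)
qed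

lemma fps_expand_homogenize:
  assumes "k > 0"
  shows "fps_expand k (homogenize d P x y) = homogenize d P (fps_expand k x) (fps_expand k y)"
proof -
  have "fps_expand k (of_int c) = of_int c" for c
    by (simp add: fps_expand_def flip: fps_of_int)
  then have "fps_expand k (of_int c * y ^ i * x ^ j) = of_int c * fps_expand k y ^ i * fps_expand k x ^ j" for c i j
    by (simp add: fps_expand_mult fps_expand_power assms)
  then show ?thesis
    by (simp add: homogenize_def) (simp add: fps_expand_def fps_compose_sum_distrib)
qed

text \<open>Under \<open>q |-> q^2\<close> the mean relations turn \<open>4 * A\<close> into
  \<open>(s + t)\<^sup>2\<close> and \<open>4 * L\<close> into \<open>(s - t)\<^sup>2\<close>
  (Landen's transformation). The polynomial congruence assumed for \<open>H\<close> thus says that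
  \<open>4 ^ d * E(q^2)\<close> is congruent to \<open>E(q)\<close>, and the factor
  \<open>4 ^ d\<close> is 1 modulo \<open>p\<close>.\<close>

lemma fcong_homogenize_theta_1:
  assumes id: "\<And>s t :: int fps. of_nat p dvd homogenize d H ((s + t)\<^sup>2) ((s - t)\<^sup>2) - homogenize d H (s\<^sup>2) (s\<^sup>2 - t\<^sup>2)"
    and p: "int p dvd 4 ^ d - 1" and H0: "coeff H 0 = 1"
  shows "fcong p (homogenize d H (theta ^ 4) theta_diff) 1"
proof (rule fcong_1_if_expand)
  define E where "E = homogenize d H (theta ^ 4) theta_diff"
  define s t where "s = theta\<^sup>2" and "t = theta_alt\<^sup>2"
  have s: "2 * fps_expand 2 s = s + t" using theta_square_add by (simp add: s_def t_def)
  have t: "fps_expand 2 t = theta * theta_alt" by (simp add: t_def theta_mult_theta_alt)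
  have A: "theta ^ 4 = s\<^sup>2" and B: "theta_alt ^ 4 = t\<^sup>2" by (simp_all add: s_def t_def flip: power_mult)
  have EA: "4 * fps_expand 2 (theta ^ 4) = (s + t)\<^sup>2"
    unfolding A s[symmetric] by (simp add: fps_expand_power power_mult_distrib)
  have "4 * fps_expand 2 theta_diff = (s + t)\<^sup>2 - 4 * (theta * theta_alt)\<^sup>2"
    unfolding theta_diff_def fps_expand_diff right_diff_distrib EA B by (simp add: fps_expand_power t)
  also have "(theta * theta_alt)\<^sup>2 = s * t" by (simp add: s_def t_def power_mult_distrib)
  also have "(s + t)\<^sup>2 - 4 * (s * t) = (s - t)\<^sup>2" by (simp add: power2_eq_square algebra_simps)
  finally have EL: "4 * fps_expand 2 theta_diff = (s - t)\<^sup>2" .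
  have "4 ^ d * fps_expand 2 E = homogenize d H ((s + t)\<^sup>2) ((s - t)\<^sup>2)"
    by (simp add: E_def fps_expand_homogenize EA EL flip: homogenize_scale)
  moreover have "E = homogenize d H (s\<^sup>2) (s\<^sup>2 - t\<^sup>2)"
    by (simp add: E_def A B theta_diff_def)
  ultimately have 1: "fcong p (4 ^ d * fps_expand 2 E) E"
    using id by (simp add: fcong_def)
  have "fcong p (of_int (4 ^ d)) (of_int 1)"
  proof -
    obtain k where "4 ^ d - 1 = int p * k" using p by (elim dvdE)
    then have "of_int (4 ^ d) - of_int 1 = of_nat p * (of_int k :: int fps)"
      by (simp only: of_int_mult of_int_of_nat_eq flip: of_int_diff)
    then show ?thesis by (simp only: fcong_def dvd_triv_left)
  qed
  then have "fcong p (4 ^ d * fps_expand 2 E) (1 * fps_expand 2 E)"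
    by (intro fcong_mult fcong_refl) simp
  then show "fcong p (fps_expand 2 E) E"
    using 1 fcong_sym fcong_trans by (metis mult_1)
  have "E $ 0 = (\<Sum>i\<in>{0}. (of_int (coeff H i) * theta_diff ^ i * (theta ^ 4) ^ (d - i)) $ 0)"
    unfolding E_def homogenize_def fps_sum_nth
    by (rule sum.mono_neutral_right) (auto simp: fps_power_zeroth)
  then show "int p dvd E $ 0 - 1"
    by (simp add: H0 fps_power_zeroth)
qed

text \<open>The polynomials \<open>\<Sum>n<p. (2n choose n)\<^sup>2 (\<lambda>/16)\<^sup>n\<close> reduced modulo \<open>p\<close>.\<close>
definition hasse_11 :: "int poly" where
  "hasse_11 = [:1, 3, 1, 1, 3, 1:]"

definition hasse_13 :: "int poly" where
  "hasse_13 = [:1, -3, 4, -3, 4, -3, 1:]"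

lemma fcong_hasse_11: "fcong 11 (homogenize 5 hasse_11 (theta ^ 4) theta_diff) 1"
proof (rule fcong_homogenize_theta_1)
  fix s t :: "int fps"
  \<comment> \<open>The second factor is the exact quotient by 11, so that the congruence becomes an
    identity over the integers.\<close>
  have "homogenize 5 hasse_11 ((s + t)\<^sup>2) ((s - t)\<^sup>2) - homogenize 5 hasse_11 (s\<^sup>2) (s\<^sup>2 - t\<^sup>2) =
      11 * (17 * s ^ 8 * t\<^sup>2 + 28 * s ^ 6 * t ^ 4 + 33 * s ^ 4 * t ^ 6 + 14 * s\<^sup>2 * t ^ 8 + t ^ 10)"
    unfolding hasse_11_def by (simp add: homogenize_simps) algebra
  then show "of_nat 11 dvd homogenize 5 hasse_11 ((s + t)\<^sup>2) ((s - t)\<^sup>2) - homogenize 5 hasse_11 (s\<^sup>2) (s\<^sup>2 - t\<^sup>2)"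
    by (simp only: of_nat_numeral dvd_triv_left)
qed (simp_all add: hasse_11_def)

lemma fcong_hasse_13: "fcong 13 (homogenize 6 hasse_13 (theta ^ 4) theta_diff) 1"
proof (rule fcong_homogenize_theta_1)
  fix s t :: "int fps"
  have "homogenize 6 hasse_13 ((s + t)\<^sup>2) ((s - t)\<^sup>2) - homogenize 6 hasse_13 (s\<^sup>2) (s\<^sup>2 - t\<^sup>2) =
      13 * (s ^ 10 * t\<^sup>2 + 55 * s ^ 8 * t ^ 4 + 203 * s ^ 6 * t ^ 6 + 55 * s ^ 4 * t ^ 8 + s\<^sup>2 * t ^ 10)"
    unfolding hasse_13_def by (simp add: homogenize_simps) algebra
  then show "of_nat 13 dvd homogenize 6 hasse_13 ((s + t)\<^sup>2) ((s - t)\<^sup>2) - homogenize 6 hasse_13 (s\<^sup>2) (s\<^sup>2 - t\<^sup>2)"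
    by (simp only: of_nat_numeral dvd_triv_left)
qed (simp_all add: hasse_13_def)

text \<open>The indices divisible by 11 are those that U retains; the polynomial has degree 25, so
  index 33 gives 0. The analogue for 13 has degree 36.\<close>

lemma coeff_hasse_11:
  "coeff (hasse_11 ^ 3 * [:1, -1:] ^ 10) 0 = 1"
  "coeff (hasse_11 ^ 3 * [:1, -1:] ^ 10) 11 = - 3357"
  "coeff (hasse_11 ^ 3 * [:1, -1:] ^ 10) 22 = 33"
  "coeff (hasse_11 ^ 3 * [:1, -1:] ^ 10) 33 = 0"
  by (simp_all add: hasse_11_def eval_nat_numeral)

lemma coeff_hasse_13:
  "coeff (hasse_13 ^ 4 * [:1, -1:] ^ 12) 0 = 1"
  "coeff (hasse_13 ^ 4 * [:1, -1:] ^ 12) 13 = - 23738432"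
  "coeff (hasse_13 ^ 4 * [:1, -1:] ^ 12) 26 = 5548624"
  "coeff (hasse_13 ^ 4 * [:1, -1:] ^ 12) 39 = 0"
  by (simp_all add: hasse_13_def eval_nat_numeral)

lemma homogenize_theta_diff: "homogenize 1 [:1, -1:] (theta ^ 4) theta_diff = theta_alt ^ 4"
  by (simp add: homogenize_simps theta_diff_def)

lemma fcong_of_int: "int p dvd c - d \<Longrightarrow> fcong p (of_int c * f) (of_int d * f)"
  by (auto simp: fcong_nth_iff simp flip: fps_of_int left_diff_distrib)

text \<open>Of the \<open>p\<close> factors \<open>theta_alt ^ 4\<close>, all but one become powers
  of \<open>A - L\<close>, the form of \<open>1 - x\<close>; the last one is kept as the logarithmic
  derivative. Inserting \<open>r\<close> copies of the Hasse form, each congruent to 1, raises the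
  total degree to a multiple of \<open>p\<close>.\<close>

lemma fcong_extract_via_homogenize:
  assumes p: "prime p" "p \<noteq> 2"
    and E: "fcong p (homogenize h H (theta ^ 4) theta_diff) 1" and deg: "degree H \<le> h"
    and fg: "f * g ^ p = (theta ^ 4) ^ k * (theta_alt ^ 4) ^ p"
    and m: "k + (r * h + (p - 1)) = p * m"
  shows "fcong p (fps_extract p f * g)
    ((\<Sum>j\<le>m. of_int (coeff (H ^ r * [:1, -1:] ^ (p - 1)) (p * j)) * theta_diff ^ j * (theta ^ 4) ^ (m - j)) * theta_alt ^ 4)"
proof -
  define A B L where "A = theta ^ 4" and "B = theta_alt ^ 4" and "L = theta_diff"
  define N where "N = H ^ r * [:1, -1 :: int:] ^ (p - 1)"
  define E' where "E' = homogenize h H A L"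
  have p0: "p > 0" using p prime_gt_0_nat by blast
  have B1: "B = homogenize 1 [:1, -1:] A L"
    using homogenize_theta_diff by (simp add: A_def B_def L_def)
  have dH: "degree (H ^ r) \<le> r * h"
    using degree_power_le[of H r] mult_le_mono1[OF deg, of r] by (metis le_trans mult.commute)
  have d1: "degree ([:1, -1 :: int:] ^ (p - 1)) \<le> (p - 1) * 1"
    using degree_power_le[of "[:1, -1 :: int:]" "p - 1"] by simp
  have dN: "degree N \<le> r * h + (p - 1) * 1"
    unfolding N_def using degree_mult_le dH d1 by (meson add_mono le_trans)
  have hN: "homogenize (p * m) N A L = A ^ k * (E' ^ r * B ^ (p - 1))"
  proof -
    have "p * m = k + (r * h + (p - 1) * 1)" using m by simp
    then have "homogenize (p * m) N A L = A ^ k * homogenize (r * h + (p - 1) * 1) N A L"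
      using homogenize_shift[OF dN] by simp
    also have "homogenize (r * h + (p - 1) * 1) N A L = E' ^ r * B ^ (p - 1)"
      unfolding N_def homogenize_mult[OF dH d1] E'_def B1
      by (subst homogenize_power[OF deg], subst homogenize_power) simp_all
    finally show ?thesis .
  qed
  have "fcong p (fps_extract p f * g) (fps_extract p (f * g ^ p))"
    by (rule fcong_sym, rule fcong_extract_mult_power, rule p)
  also have "f * g ^ p = A ^ k * (1 ^ r * B ^ (p - 1)) * B"
    using power_minus_mult[OF p0, of B] by (simp add: fg A_def B_def mult.assoc)
  also have "fcong p (fps_extract p (A ^ k * (1 ^ r * B ^ (p - 1)) * B)) (fps_extract p (A ^ k * (E' ^ r * B ^ (p - 1)) * B))"
    unfolding E'_def A_def L_def by (intro fcong_extract fcong_mult fcong_power fcong_refl fcong_sym[OF E])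
  also have "fps_extract p (A ^ k * (E' ^ r * B ^ (p - 1)) * B) = fps_extract p (homogenize (p * m) N A L * B)"
    by (simp only: hN)
  also have "fcong p \<dots> ((\<Sum>j\<le>m. of_int (coeff N (p * j)) * L ^ j * A ^ (m - j)) * B)"
    unfolding A_def B_def L_def by (rule fcong_extract_homogenize[OF p])
  finally show ?thesis by (simp only: N_def A_def B_def L_def)
qed

lemma sum_atMost_3: "(\<Sum>j\<le>3. f j) = f 0 + f 1 + f 2 + f (3 :: nat)"
  by (simp add: numeral_3_eq_3 numeral_2_eq_2)

section \<open>U of the reciprocal theta series for p = 11 and p = 13\<close>

lemma fcong_extract_inverse_theta_11:
  assumes "P * theta = 1"
  shows "fcong 11 (fps_extract 11 P) (theta ^ 9 - 2 * theta ^ 5 * theta_diff)"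
proof -
  have prime: "prime (11 :: nat)" by simp
  define h where "h = theta ^ 3 * theta_alt ^ 4"
  have "P * theta ^ 11 = P * theta * theta ^ 10" by algebra
  then have "fcong 11 (fps_extract 11 P * theta) (fps_extract 11 (theta ^ 10))"
    using fcong_extract_mult_power[OF prime, of P theta] assms by (simp add: fcong_sym)
  then have "fcong 11 (fps_extract 11 P * theta * (theta\<^sup>2 * theta_alt ^ 4)) (fps_extract 11 (theta ^ 10) * (theta\<^sup>2 * theta_alt ^ 4))"
    by (rule fcong_mult) simp
  \<comment> \<open>The factor \<open>theta\<^sup>2\<close> makes
    \<open>theta ^ 10 * theta ^ 22\<close> equal to \<open>A ^ 8\<close>; three Hasse factors then
    give the degree \<open>8 + 15 + 10 = 33\<close>.\<close>
  also have "fcong 11 (fps_extract 11 (theta ^ 10) * (theta\<^sup>2 * theta_alt ^ 4))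
     ((\<Sum>j\<le>3. of_int (coeff (hasse_11 ^ 3 * [:1, -1:] ^ (11 - 1)) (11 * j)) * theta_diff ^ j * (theta ^ 4) ^ (3 - j)) * theta_alt ^ 4)"
    by (rule fcong_extract_via_homogenize[where k = 8, OF prime _ fcong_hasse_11])
      (simp_all add: hasse_11_def power_mult_distrib flip: power_mult power_add)
  also have "(\<Sum>j\<le>3. of_int (coeff (hasse_11 ^ 3 * [:1, -1:] ^ (11 - 1)) (11 * j)) * theta_diff ^ j * (theta ^ 4) ^ (3 - j)) =
      of_int 1 * (theta ^ 4) ^ 3 + of_int (- 3357) * (theta_diff * (theta ^ 4)\<^sup>2) + of_int 33 * (theta_diff\<^sup>2 * theta ^ 4)"
    using coeff_hasse_11 by (simp add: sum_atMost_3 mult.assoc flip: power_mult)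
  also have "fcong 11 (\<dots> * theta_alt ^ 4)
      ((of_int 1 * (theta ^ 4) ^ 3 + of_int (- 2) * (theta_diff * (theta ^ 4)\<^sup>2) + of_int 0 * (theta_diff\<^sup>2 * theta ^ 4)) * theta_alt ^ 4)"
    by (intro fcong_mult fcong_add fcong_of_int fcong_refl) simp_all
  also have "\<dots> = h * (theta ^ 9 - 2 * theta ^ 5 * theta_diff)"
    unfolding h_def by simp algebra
  also have "fps_extract 11 P * theta * (theta\<^sup>2 * theta_alt ^ 4) = h * fps_extract 11 P"
    unfolding h_def by algebra
  finally show ?thesis
    by (rule fcong_mult_cancel[OF prime, of _ 0, rotated]) (simp add: h_def fps_power_zeroth)
qed

lemma fcong_extract_inverse_theta_13:
  assumes "P * theta = 1"
  shows "fcong 13 (fps_extract 13 P) (theta ^ 11 - 3 * theta ^ 7 * theta_diff + 3 * theta ^ 3 * theta_diff\<^sup>2)"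
proof -
  have prime: "prime (13 :: nat)" by simp
  define h where "h = theta * theta_alt ^ 4"
  have "P * theta ^ 13 = P * theta * theta ^ 12" by algebra
  then have "fcong 13 (fps_extract 13 P * theta) (fps_extract 13 (theta ^ 12))"
    using fcong_extract_mult_power[OF prime, of P theta] assms by (simp add: fcong_sym)
  then have "fcong 13 (fps_extract 13 P * theta * theta_alt ^ 4) (fps_extract 13 (theta ^ 12) * theta_alt ^ 4)"
    by (rule fcong_mult) simp
  \<comment> \<open>Here \<open>theta ^ 12\<close> is already \<open>A ^ 3\<close>, and four Hasse
    factors give the degree \<open>3 + 24 + 12 = 39\<close>.\<close>
  also have "fcong 13 (fps_extract 13 (theta ^ 12) * theta_alt ^ 4)
     ((\<Sum>j\<le>3. of_int (coeff (hasse_13 ^ 4 * [:1, -1:] ^ (13 - 1)) (13 * j)) * theta_diff ^ j * (theta ^ 4) ^ (3 - j)) * theta_alt ^ 4)"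
    by (rule fcong_extract_via_homogenize[where k = 3, OF prime _ fcong_hasse_13])
      (simp_all add: hasse_13_def flip: power_mult)
  also have "(\<Sum>j\<le>3. of_int (coeff (hasse_13 ^ 4 * [:1, -1:] ^ (13 - 1)) (13 * j)) * theta_diff ^ j * (theta ^ 4) ^ (3 - j)) =
      of_int 1 * (theta ^ 4) ^ 3 + of_int (- 23738432) * (theta_diff * (theta ^ 4)\<^sup>2) + of_int 5548624 * (theta_diff\<^sup>2 * theta ^ 4)"
    using coeff_hasse_13 by (simp add: sum_atMost_3 mult.assoc flip: power_mult)
  also have "fcong 13 (\<dots> * theta_alt ^ 4)
      ((of_int 1 * (theta ^ 4) ^ 3 + of_int (- 3) * (theta_diff * (theta ^ 4)\<^sup>2) + of_int 3 * (theta_diff\<^sup>2 * theta ^ 4)) * theta_alt ^ 4)"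
    by (intro fcong_mult fcong_add fcong_of_int fcong_refl) simp_all
  also have "\<dots> = h * (theta ^ 11 - 3 * theta ^ 7 * theta_diff + 3 * theta ^ 3 * theta_diff\<^sup>2)"
    unfolding h_def by simp algebra
  also have "fps_extract 13 P * theta * theta_alt ^ 4 = h * fps_extract 13 P"
    unfolding h_def by algebra
  finally show ?thesis
    by (rule fcong_mult_cancel[OF prime, of _ 0, rotated]) (simp add: h_def fps_power_zeroth)
qed

text \<open>The residue \<open>r\<close> is reduced here so that products and powers may add
  residues freely.\<close>

definition supported_mod :: "nat \<Rightarrow> nat \<Rightarrow> int fps \<Rightarrow> bool" where
  "supported_mod m r f \<longleftrightarrow> (\<forall>n. n mod m \<noteq> r mod m \<longrightarrow> f $ n = 0)"

lemma supported_mod_mult: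
  assumes "supported_mod m r f" "supported_mod m s g"
  shows "supported_mod m (r + s) (f * g)"
  unfolding supported_mod_def
proof (intro allI impI)
  fix n assume n: "n mod m \<noteq> (r + s) mod m"
  show "(f * g) $ n = 0"
    unfolding fps_mult_nth
  proof (intro sum.neutral ballI)
    fix i assume i: "i \<in> {0..n}"
    have "i mod m \<noteq> r mod m \<or> (n - i) mod m \<noteq> s mod m"
    proof (rule ccontr)
      assume "\<not> ?thesis"
      then have "(i + (n - i)) mod m = (r + s) mod m" by (metis mod_add_cong)
      then show False using i n by simp
    qed
    then show "f $ i * g $ (n - i) = 0" using assms by (auto simp: supported_mod_def)
  qed
qed

lemma supported_mod_power: "supported_mod m r f \<Longrightarrow> supported_mod m (k * r) (f ^ k)"
  by (induction k) (auto intro: supported_mod_mult, simp add: supported_mod_def)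

lemma fps_expand_4: "fps_expand 4 f = fps_expand 2 (fps_expand 2 f)"
proof (rule fps_ext)
  fix n
  have "4 dvd n \<longleftrightarrow> even n \<and> even (n div 2)" for n :: nat by presburger
  moreover have "n div 4 = n div 2 div 2" for n :: nat by presburger
  ultimately show "fps_expand 4 f $ n = fps_expand 2 (fps_expand 2 f) $ n"
    by (simp add: fps_expand_nth)
qed

text \<open>Two steps of the mean: \<open>4 * L(q^2) = (a\<^sup>2 - b\<^sup>2)\<^sup>2\<close>, and
  at the next step the difference of squares becomes \<open>(a - b)\<^sup>2\<close> up to a factor
  2, where \<open>a - b = 2 * theta_odd\<close>.\<close>

lemma fps_expand_4_theta_diff: "fps_expand 4 theta_diff = theta_odd ^ 4"
proof -
  have s: "2 * fps_expand 2 (theta\<^sup>2) = theta\<^sup>2 + theta_alt\<^sup>2" using theta_square_add by simp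
  have "4 * fps_expand 2 theta_diff = (2 * fps_expand 2 (theta\<^sup>2))\<^sup>2 - 4 * (theta * theta_alt)\<^sup>2"
    by (simp add: theta_diff_def fps_expand_diff theta_mult_theta_alt flip: power_mult fps_expand_power)
  also have "\<dots> = (theta\<^sup>2 - theta_alt\<^sup>2)\<^sup>2"
    unfolding s by algebra
  finally have "4 * fps_expand 2 (4 * fps_expand 2 theta_diff) = 4 * fps_expand 2 ((theta\<^sup>2 - theta_alt\<^sup>2)\<^sup>2)" by simp
  then have "16 * fps_expand 4 theta_diff = 4 * (fps_expand 2 (theta\<^sup>2) - fps_expand 2 (theta_alt\<^sup>2))\<^sup>2"
    by (simp add: fps_expand_4 fps_expand_mult fps_expand_power fps_expand_diff)
  also have "\<dots> = (2 * fps_expand 2 (theta\<^sup>2) - 2 * fps_expand 2 (theta_alt\<^sup>2))\<^sup>2"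
    by algebra
  also have "\<dots> = ((theta - theta_alt)\<^sup>2)\<^sup>2"
    unfolding s theta_mult_theta_alt[symmetric] by algebra
  also have "theta - theta_alt = 2 * theta_odd" using theta_conv_parts by algebra
  finally show ?thesis by (simp add: power_mult_distrib flip: power_mult)
qed

lemma supported_mod_theta_odd: "supported_mod 8 1 theta_odd" "supported_mod 4 1 theta_odd"
proof -
  show "supported_mod 8 1 theta_odd" by (auto simp: supported_mod_def intro: theta_odd_nth_eq_0)
  have "n mod 8 = 1 \<Longrightarrow> n mod 4 = 1" for n :: nat by presburger
  then show "supported_mod 4 1 theta_odd" by (auto simp: supported_mod_def intro!: theta_odd_nth_eq_0)
qed

lemma supported_mod_expand: "m > 0 \<Longrightarrow> supported_mod m 0 (fps_expand m f)"
  by (auto simp: supported_mod_def fps_expand_nth)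

section \<open>Dissection modulo 8\<close>

lemma fps_expand_uminus: "fps_expand k (- f) = - fps_expand k f"
  by (simp add: fps_expand_def fps_compose_uminus)

lemma nth_odd_power_mult_expand_eq_0:
  assumes "n mod 4 \<noteq> k mod 4"
  shows "(theta_odd ^ k * fps_expand 4 g) $ n = 0"
proof -
  have "supported_mod 4 (k * 1 + 0) (theta_odd ^ k * fps_expand 4 g)"
    by (intro supported_mod_mult supported_mod_power supported_mod_theta_odd supported_mod_expand) simp
  then show ?thesis using assms by (simp add: supported_mod_def)
qed

lemma fps_extract_4_split:
  "fps_extract 4 (fps_expand 4 g0 + theta_odd * fps_expand 4 g1 + theta_odd\<^sup>2 * fps_expand 4 g2 +
    theta_odd ^ 3 * fps_expand 4 g3) = g0"
proof (rule fps_ext)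
  fix n
  have "(theta_odd ^ k * fps_expand 4 g) $ (4 * n) = 0" if "k \<in> {1, 2, 3}" for k g
    by (rule nth_odd_power_mult_expand_eq_0) (use that in auto)
  from this[of 1 g1] this[of 2 g2] this[of 3 g3]
  show "fps_extract 4 (fps_expand 4 g0 + theta_odd * fps_expand 4 g1 + theta_odd\<^sup>2 * fps_expand 4 g2 +
    theta_odd ^ 3 * fps_expand 4 g3) $ n = g0 $ n"
    by simp
qed

text \<open>Only the odd coefficients of \<open>g\<close> contribute, because \<open>y\<^sup>k\<close> lives on exponents \<open>k\<close> mod 8.\<close>
lemma dvd_nth_odd_power_mult_expand:
  assumes "\<And>j. odd j \<Longrightarrow> d dvd g $ j"
  shows "d dvd (theta_odd ^ k * fps_expand 4 g) $ (8 * n + (4 + k))"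
  unfolding fps_mult_nth
proof (intro dvd_sum)
  fix i assume i: "i \<in> {0..8 * n + (4 + k)}"
  have supp: "supported_mod 8 (k * 1) (theta_odd ^ k)"
    by (intro supported_mod_power supported_mod_theta_odd)
  show "d dvd (theta_odd ^ k) $ i * fps_expand 4 g $ (8 * n + (4 + k) - i)"
  proof (cases "i mod 8 = k mod 8")
    case False
    then show ?thesis using supp by (simp add: supported_mod_def)
  next
    case True
    define m where "m = 8 * n + (4 + k) - i"
    have "(m + i) mod 8 = (4 + k) mod 8" using i by (simp add: m_def)
    then have "(m + k) mod 8 = (4 + k) mod 8" using True by (metis mod_add_right_eq)
    then have "[m + k = 4 + k] (mod 8)" by (simp add: cong_def)
    then have "[m = 4] (mod 8)" by (simp only: cong_add_rcancel_nat)
    then have "m = 8 * (m div 8) + 4" using mult_div_mod_eq[of 8 m] by (simp add: cong_def)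
    then obtain c where "m = 8 * c + 4" by blast
    then have "odd (m div 4)" by simp
    then show ?thesis using assms by (simp add: fps_expand_nth flip: m_def)
  qed
qed

lemma theta_diff_compose_neg_X: "theta_diff oo (- fps_X) = - theta_diff"
  by (simp add: theta_diff_def fps_compose_sub_distrib fps_compose_power[symmetric] theta_alt_compose_neg_X
      flip: theta_alt_def)

text \<open>Under \<open>q |-> -q\<close> the series \<open>theta ^ 4\<close> and
  \<open>theta_alt ^ 4\<close> are exchanged and \<open>theta_diff\<close> changes sign. Twice the
  odd part is therefore \<open>c1 + c5\<close> times an integral series.\<close>

lemma dvd_odd_nth_weight_4:
  assumes p: "prime p" "p \<noteq> 2" and dvd: "int p dvd c1 + c5" and j: "odd j"
  shows "int p dvd (of_int c1 * theta ^ 8 + of_int c5 * theta ^ 4 * theta_diff + of_int c9 * theta_diff\<^sup>2) $ j"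
    (is "_ dvd ?g $ j")
proof -
  have of_int_neg: "of_int c oo (- fps_X) = (of_int c :: int fps)" for c
    by (simp flip: fps_of_int)
  have "?g oo (- fps_X) = of_int c1 * theta_alt ^ 8 - of_int c5 * theta_alt ^ 4 * theta_diff + of_int c9 * theta_diff\<^sup>2"
    by (simp add: fps_compose_add_distrib fps_compose_mult_distrib fps_compose_power[symmetric] of_int_neg
        theta_diff_compose_neg_X flip: theta_alt_def)
  then have "?g - (?g oo (- fps_X)) = of_int (c1 + c5) * ((theta ^ 4 + theta_alt ^ 4) * theta_diff)"
    unfolding theta_diff_def by (simp add: algebra_simps flip: power_add)
  from arg_cong[OF this, of "\<lambda>f. f $ j"]
  have "2 * ?g $ j = (c1 + c5) * ((theta ^ 4 + theta_alt ^ 4) * theta_diff) $ j"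
    using j by (simp add: fps_compose_neg_X_nth flip: fps_of_int)
  with dvd have "int p dvd 2 * ?g $ j" by simp
  moreover have "\<not> int p dvd 2" using p primes_dvd_imp_eq[of p 2] by (metis int_dvd_int_iff of_nat_numeral two_is_prime_nat)
  ultimately show ?thesis using p(1) by (metis prime_dvd_mult_iff prime_nat_int_transfer)
qed

lemma dvd_nth_weight_9_2:
  "11 dvd (theta ^ 9 - 2 * theta ^ 5 * theta_diff) $ (8 * n + 5)"
proof -
  define x y z where "x = fps_expand 4 theta" and "y = theta_odd" and "z = fps_expand 4 theta_diff"
  \<comment> \<open>Coefficients of the powers of \<open>y\<close> after substituting
    \<open>theta = x + y\<close>, \<open>theta_alt = x - y\<close> and \<open>y ^ 4 = z\<close>. At
    \<open>8 * n + 5\<close> only the first power of \<open>y\<close> matters, and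
    \<open>-7 - 114 = -121\<close> is divisible by 11.\<close>
  define g1 where "g1 = of_int (- 7) * theta ^ 8 + of_int (- 114) * theta ^ 4 * theta_diff + of_int 1 * theta_diff\<^sup>2"
  define g0 where "g0 = theta ^ 9 - 114 * theta ^ 5 * theta_diff - 7 * theta * theta_diff\<^sup>2"
  define g2 where "g2 = - (44 * theta ^ 7) - 92 * theta ^ 3 * theta_diff"
  define g3 where "g3 = - (92 * theta ^ 6) - 44 * theta\<^sup>2 * theta_diff"
  have z: "z = y ^ 4" by (simp add: z_def y_def fps_expand_4_theta_diff)
  have "theta ^ 9 - 2 * theta ^ 5 * theta_diff = (x + y) ^ 9 - 2 * (x + y) ^ 5 * ((x + y) ^ 4 - (x - y) ^ 4)"
    unfolding theta_diff_def x_def y_def by (simp flip: theta_conv_parts)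
  also have "\<dots> = (x ^ 9 - 114 * x ^ 5 * z - 7 * x * z\<^sup>2) + y * (- (7 * x ^ 8) - 114 * x ^ 4 * z + z\<^sup>2)
      + y\<^sup>2 * (- (44 * x ^ 7) - 92 * x ^ 3 * z) + y ^ 3 * (- (92 * x ^ 6) - 44 * x\<^sup>2 * z)"
    unfolding z by algebra
  also have "\<dots> = y ^ 0 * fps_expand 4 g0 + y ^ 1 * fps_expand 4 g1 + y\<^sup>2 * fps_expand 4 g2 + y ^ 3 * fps_expand 4 g3"
    by (simp add: g0_def g1_def g2_def g3_def x_def z_def fps_expand_add fps_expand_diff fps_expand_mult
        fps_expand_power fps_expand_uminus)
  finally have eq: "theta ^ 9 - 2 * theta ^ 5 * theta_diff =
    y ^ 0 * fps_expand 4 g0 + y ^ 1 * fps_expand 4 g1 + y\<^sup>2 * fps_expand 4 g2 + y ^ 3 * fps_expand 4 g3" .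
  have 0: "(y ^ k * fps_expand 4 g) $ (8 * n + 5) = 0" if "k \<in> {0, 2, 3}" for k g
    unfolding y_def by (rule nth_odd_power_mult_expand_eq_0) (use that in \<open>auto, presburger+\<close>)
  have "int 11 dvd (y ^ 1 * fps_expand 4 g1) $ (8 * n + (4 + 1))"
    unfolding y_def g1_def by (intro dvd_nth_odd_power_mult_expand dvd_odd_nth_weight_4) simp_all
  then show ?thesis unfolding eq using 0[of 0 g0] 0[of 2 g2] 0[of 3 g3] by simp
qed

text \<open>This three-parameter family is stable under \<open>fps_extract 4\<close>, which acts
  linearly on the coefficients.\<close>

definition theta_form :: "int \<Rightarrow> int \<Rightarrow> int \<Rightarrow> int fps" where
  "theta_form c0 c1 c2 = of_int c0 * theta ^ 11 + of_int c1 * theta ^ 7 * theta_diff + of_int c2 * theta ^ 3 * theta_diff\<^sup>2"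

lemma theta_form_dissection:
  "theta_form c0 c1 c2 =
    fps_expand 4 (theta_form c0 (330 * c0 + 336 * c1 + 320 * c2) (165 * c0 + 176 * c1 + 192 * c2)) +
    theta_odd * fps_expand 4 (of_int (11 * c0 + 8 * c1) * theta ^ 10 + of_int (462 * c0 + 448 * c1 + 448 * c2) * theta ^ 6 * theta_diff
      + of_int (55 * c0 + 56 * c1 + 64 * c2) * theta\<^sup>2 * theta_diff\<^sup>2) +
    theta_odd\<^sup>2 * fps_expand 4 (of_int (55 * c0 + 56 * c1 + 64 * c2) * theta ^ 9 + of_int (462 * c0 + 448 * c1 + 448 * c2) * theta ^ 5 * theta_diff
      + of_int (11 * c0 + 8 * c1) * theta * theta_diff\<^sup>2) +
    theta_odd ^ 3 * fps_expand 4 (of_int (165 * c0 + 176 * c1 + 192 * c2) * theta ^ 8 + of_int (330 * c0 + 336 * c1 + 320 * c2) * theta ^ 4 * theta_diff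
      + of_int c0 * theta_diff\<^sup>2)"
proof -
  define x y z where "x = fps_expand 4 theta" and "y = theta_odd" and "z = fps_expand 4 theta_diff"
  define a b c where "a = (of_int c0 :: int fps)" and "b = (of_int c1 :: int fps)" and "c = (of_int c2 :: int fps)"
  have z: "z = y ^ 4" by (simp add: z_def y_def fps_expand_4_theta_diff)
  have abc: "fps_expand 4 a = a" "fps_expand 4 b = b" "fps_expand 4 c = c"
    by (simp_all add: a_def b_def c_def fps_expand_def flip: fps_of_int)
  have "theta_form c0 c1 c2 = a * (x + y) ^ 11 + b * (x + y) ^ 7 * ((x + y) ^ 4 - (x - y) ^ 4)
      + c * (x + y) ^ 3 * ((x + y) ^ 4 - (x - y) ^ 4)\<^sup>2"
    unfolding theta_form_def theta_diff_def x_def y_def a_def b_def c_def by (simp flip: theta_conv_parts)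
  also have "\<dots> = (a * x ^ 11 + (330 * a + 336 * b + 320 * c) * x ^ 7 * z + (165 * a + 176 * b + 192 * c) * x ^ 3 * z\<^sup>2) +
      y * ((11 * a + 8 * b) * x ^ 10 + (462 * a + 448 * b + 448 * c) * x ^ 6 * z + (55 * a + 56 * b + 64 * c) * x\<^sup>2 * z\<^sup>2) +
      y\<^sup>2 * ((55 * a + 56 * b + 64 * c) * x ^ 9 + (462 * a + 448 * b + 448 * c) * x ^ 5 * z + (11 * a + 8 * b) * x * z\<^sup>2) +
      y ^ 3 * ((165 * a + 176 * b + 192 * c) * x ^ 8 + (330 * a + 336 * b + 320 * c) * x ^ 4 * z + a * z\<^sup>2)"
    unfolding z by algebra
  finally show ?thesis
    by (simp add: theta_form_def x_def y_def z_def abc fps_expand_add fps_expand_mult fps_expand_power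
        flip: a_def b_def c_def)
qed

lemma fps_extract_4_theta_form:
  "fps_extract 4 (theta_form c0 c1 c2) =
    theta_form c0 (330 * c0 + 336 * c1 + 320 * c2) (165 * c0 + 176 * c1 + 192 * c2)"
  by (subst theta_form_dissection) (rule fps_extract_4_split)

text \<open>At \<open>8 * n + 7\<close> only the \<open>theta_odd ^ 3\<close> part contributes; the
  hypothesis is about the sum of the two leading coefficients there, \<open>165 + 330 = 495\<close>,
  \<open>176 + 336 = 512\<close> and \<open>192 + 320 = 512\<close>.\<close>

lemma dvd_nth_theta_form:
  assumes p: "prime p" "p \<noteq> 2" and dvd: "int p dvd 495 * c0 + 512 * c1 + 512 * c2"
  shows "int p dvd theta_form c0 c1 c2 $ (8 * n + 7)"
proof -
  have 0: "(theta_odd ^ k * fps_expand 4 g) $ (8 * n + 7) = 0" if "k \<in> {0, 1, 2}" for k g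
    by (rule nth_odd_power_mult_expand_eq_0) (use that in \<open>auto, presburger+\<close>)
  have 3: "int p dvd (theta_odd ^ 3 * fps_expand 4 (of_int a * theta ^ 8 + of_int b * theta ^ 4 * theta_diff
      + of_int c0 * theta_diff\<^sup>2)) $ (8 * n + (4 + 3))" if "int p dvd a + b" for a b
    by (intro dvd_nth_odd_power_mult_expand dvd_odd_nth_weight_4 p that)
  show ?thesis
    using 3[of "165 * c0 + 176 * c1 + 192 * c2" "330 * c0 + 336 * c1 + 320 * c2"] dvd 0[of 0] 0[of 1] 0[of 2]
    by (subst theta_form_dissection) (simp add: algebra_simps)
qed

section \<open>The two congruences for the reciprocal theta series\<close>

lemma dvd_nth_inverse_theta_11:
  assumes "P * theta = 1"
  shows "11 dvd P $ (11 * (8 * n + 5))"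
proof -
  define Q where "Q = theta ^ 9 - 2 * theta ^ 5 * theta_diff"
  have "fcong 11 (fps_extract 11 P) Q"
    unfolding Q_def by (rule fcong_extract_inverse_theta_11[OF assms])
  then have "11 dvd P $ (11 * (8 * n + 5)) - Q $ (8 * n + 5)"
    unfolding fcong_nth_iff by (metis fps_extract_nth of_nat_numeral)
  moreover have "11 dvd Q $ (8 * n + 5)" unfolding Q_def by (rule dvd_nth_weight_9_2)
  ultimately show ?thesis by (metis dvd_add diff_add_cancel)
qed

lemma dvd_nth_inverse_theta_13:
  assumes "P * theta = 1"
  shows "13 dvd P $ (13 * (4 * (4 * (4 * (8 * n + 7)))))"
proof -
  define V where "V = (\<lambda>f. fps_extract 4 (fps_extract 4 (fps_extract 4 f)))"
  have "fcong 13 (fps_extract 13 P) (theta_form 1 (- 3) 3)"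
    using fcong_extract_inverse_theta_13[OF assms] by (simp add: theta_form_def)
  then have "fcong 13 (V (fps_extract 13 P)) (V (theta_form 1 (- 3) 3))"
    unfolding V_def by (intro fcong_extract)
  then have "13 dvd V (fps_extract 13 P) $ (8 * n + 7) - V (theta_form 1 (- 3) 3) $ (8 * n + 7)"
    by (simp add: fcong_nth_iff)
  \<comment> \<open>Modulo 13 the coefficients run through (1, -3, 3), (1, 9, 5), (1, 1, 5), (1, 4,
    1). Only the last triple passes the test of \<open>dvd_nth_theta_form\<close>, which explains
    the factor \<open>4 ^ 3 = 2 ^ 6\<close>.\<close>
  moreover have "int 13 dvd V (theta_form 1 (- 3) 3) $ (8 * n + 7)"
    unfolding V_def fps_extract_4_theta_form by (rule dvd_nth_theta_form) simp_all
  ultimately have "13 dvd V (fps_extract 13 P) $ (8 * n + 7)"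
    using dvd_add[of 13 "V (fps_extract 13 P) $ (8 * n + 7) - V (theta_form 1 (- 3) 3) $ (8 * n + 7)"] by fastforce
  then show ?thesis by (simp add: V_def)
qed

section \<open>Overpartitions\<close>

text \<open>Bounding the parts makes the generating function a finite product, and the bound is void
  once \<open>k\<close> reaches \<open>n\<close>.\<close>

definition restricted_overpartitions :: "nat \<Rightarrow> nat \<Rightarrow> (nat multiset \<times> nat set) set" where
  "restricted_overpartitions k n = {(M, S) \<in> overpartitions n. \<forall>x\<in>#M. x \<le> k}"

lemma restricted_overpartitions_0: "restricted_overpartitions 0 n = (if n = 0 then {({#}, {})} else {})"
proof -
  have "(M, S) \<in> restricted_overpartitions 0 n \<longleftrightarrow> M = {#} \<and> S = {} \<and> n = 0" for M S
  proof (cases M)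
    case empty
    then show ?thesis by (auto simp: restricted_overpartitions_def overpartitions_def)
  next
    case (add x M')
    then show ?thesis by (auto simp: restricted_overpartitions_def overpartitions_def)
  qed
  then show ?thesis by auto
qed

lemma restricted_overpartitions_eq_overpartitions:
  assumes "n \<le> k"
  shows "restricted_overpartitions k n = overpartitions n"
proof -
  have "x \<le> k" if "(M, S) \<in> overpartitions n" "x \<in># M" for M S x
  proof -
    obtain M' where "M = add_mset x M'" using \<open>x \<in># M\<close> by (meson multi_member_split)
    then show ?thesis using \<open>(M, S) \<in> overpartitions n\<close> assms by (simp add: overpartitions_def)
  qed
  then show ?thesis unfolding restricted_overpartitions_def by blast
qed

lemma restricted_overpartitions_less:
  "n < Suc k \<Longrightarrow> restricted_overpartitions (Suc k) n = restricted_overpartitions k n"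
  by (simp add: restricted_overpartitions_eq_overpartitions)

text \<open>Removing one copy of the part \<open>k + 1\<close>: if it was the last copy and overlined, a restricted
  overpartition remains, otherwise the overlining is unaffected.\<close>
lemma restricted_overpartitions_Suc:
  assumes n: "n \<ge> Suc k"
  shows "restricted_overpartitions (Suc k) n = restricted_overpartitions k n \<union>
    map_prod (add_mset (Suc k)) id ` restricted_overpartitions (Suc k) (n - Suc k) \<union>
    map_prod (add_mset (Suc k)) (insert (Suc k)) ` restricted_overpartitions k (n - Suc k)"
    (is "?L = ?A \<union> ?B \<union> ?C")
proof (intro equalityI subsetI)
  fix z assume "z \<in> ?L"
  then obtain M S where z: "z = (M, S)" and M: "\<forall>x\<in>#M. 0 < x" "sum_mset M = n" "S \<subseteq> set_mset M" "\<forall>x\<in>#M. x \<le> Suc k"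
    by (auto simp: restricted_overpartitions_def overpartitions_def)
  show "z \<in> ?A \<union> ?B \<union> ?C"
  proof (cases "Suc k \<in># M")
    case False
    then have "\<forall>x\<in>#M. x \<le> k" using M(4) by (metis le_SucE)
    then show ?thesis using M z by (simp add: restricted_overpartitions_def overpartitions_def)
  next
    case True
    then obtain M' where M': "M = add_mset (Suc k) M'" by (meson multi_member_split)
    show ?thesis
    proof (cases "S \<subseteq> set_mset M'")
      case True
      then have "(M', S) \<in> restricted_overpartitions (Suc k) (n - Suc k)"
        using M M' by (auto simp: restricted_overpartitions_def overpartitions_def)
      then show ?thesis using z M' by force
    next
      case False
      then have S: "Suc k \<in> S" "Suc k \<notin># M'" using M(3) M' by auto
      then have "\<forall>x\<in>#M'. x \<le> k" using M(4) M' by (metis le_SucE union_iff add_mset_add_single)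
      then have "(M', S - {Suc k}) \<in> restricted_overpartitions k (n - Suc k)"
        using M M' S by (auto simp: restricted_overpartitions_def overpartitions_def)
      moreover have "z = map_prod (add_mset (Suc k)) (insert (Suc k)) (M', S - {Suc k})"
        using z M' S by auto
      ultimately show ?thesis by blast
    qed
  qed
next
  fix z assume "z \<in> ?A \<union> ?B \<union> ?C"
  then show "z \<in> ?L" using n
    by (auto simp: restricted_overpartitions_def overpartitions_def intro: le_SucI)
qed

lemma finite_restricted_overpartitions [simp]: "finite (restricted_overpartitions k n)"
proof (induction k arbitrary: n)
  case 0
  then show ?case by (simp add: restricted_overpartitions_0)
next
  case (Suc k)
  show ?case
  proof (induction n rule: less_induct)
    case (less n)
    show ?case
    proof (cases "n < Suc k")
      case True
      then show ?thesis by (simp add: restricted_overpartitions_less Suc)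
    next
      case False
      then show ?thesis by (simp add: restricted_overpartitions_Suc Suc less)
    qed
  qed
qed

lemma card_restricted_overpartitions_Suc:
  assumes n: "n \<ge> Suc k"
  shows "card (restricted_overpartitions (Suc k) n) = card (restricted_overpartitions k n) +
    card (restricted_overpartitions (Suc k) (n - Suc k)) + card (restricted_overpartitions k (n - Suc k))"
proof -
  let ?A = "restricted_overpartitions k n"
  let ?B = "map_prod (add_mset (Suc k)) id ` restricted_overpartitions (Suc k) (n - Suc k)"
  let ?C = "map_prod (add_mset (Suc k)) (insert (Suc k)) ` restricted_overpartitions k (n - Suc k)"
  have sub: "S \<subseteq> set_mset M" "x \<in># M \<Longrightarrow> x \<le> k" if "(M, S) \<in> restricted_overpartitions k n" for M S x k n
    using that by (auto simp: restricted_overpartitions_def overpartitions_def)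
  have notin: "Suc k \<notin># M" "Suc k \<notin> S" if "(M, S) \<in> restricted_overpartitions k n" for M S n
    using sub[OF that] by fastforce+
  have B: "card ?B = card (restricted_overpartitions (Suc k) (n - Suc k))"
    by (rule card_image) (auto simp: inj_on_def)
  \<comment> \<open>Inserting \<open>Suc k\<close> is injective only on sets that lack it, which the
    bound \<open>k\<close> on the parts ensures.\<close>
  have C: "card ?C = card (restricted_overpartitions k (n - Suc k))"
    by (rule card_image) (auto simp: inj_on_def insert_ident dest!: notin)
  \<comment> \<open>The three pieces differ in the copies of \<open>Suc k\<close>: none in
    \<open>?A\<close>, at least one in \<open>?B\<close> and at least two if overlined, exactly one
    and overlined in \<open>?C\<close>.\<close>
  have A': "Suc k \<notin># fst z" if "z \<in> ?A" for z
    using that notin by (cases z) auto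
  have B': "Suc k \<in># fst z" "Suc k \<in> snd z \<Longrightarrow> count (fst z) (Suc k) \<ge> 2" if "z \<in> ?B" for z
    using that by (auto dest: sub(1)[THEN subsetD])
  have C': "Suc k \<in># fst z" "Suc k \<in> snd z" "count (fst z) (Suc k) = 1" if "z \<in> ?C" for z
    using that notin by (auto simp: not_in_iff)
  have "(?A \<union> ?B) \<inter> ?C = {}"
  proof -
    have False if "z \<in> ?A \<union> ?B" "z \<in> ?C" for z
      using that(1)
    proof
      assume "z \<in> ?A"
      from A'[OF this] C'(1)[OF that(2)] show False by (rule notE)
    next
      assume "z \<in> ?B"
      from B'(2)[OF this C'(2)[OF that(2)]] C'(3)[OF that(2)] show False by linarith
    qed
    then show ?thesis by (rule Int_emptyI)
  qed
  moreover have "?A \<inter> ?B = {}"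
    by (rule Int_emptyI) (rule notE[OF A' B'(1)])
  ultimately show ?thesis
    unfolding restricted_overpartitions_Suc[OF n] by (simp add: card_Un_disjoint B C)
qed

definition restricted_overpartitions_fps :: "nat \<Rightarrow> int fps" where
  "restricted_overpartitions_fps k = Abs_fps (\<lambda>n. int (card (restricted_overpartitions k n)))"

lemma restricted_overpartitions_fps_Suc:
  "restricted_overpartitions_fps (Suc k) * (1 - fps_X ^ Suc k) = restricted_overpartitions_fps k * (1 + fps_X ^ Suc k)"
proof (rule fps_ext)
  fix n
  show "(restricted_overpartitions_fps (Suc k) * (1 - fps_X ^ Suc k)) $ n =
      (restricted_overpartitions_fps k * (1 + fps_X ^ Suc k)) $ n"
    using card_restricted_overpartitions_Suc[of k n] restricted_overpartitions_less[of n k]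
    by (cases "n < Suc k")
      (simp_all add: restricted_overpartitions_fps_def right_diff_distrib' distrib_left fps_X_power_mult_right_nth del: power_Suc)
qed

lemma restricted_overpartitions_fps_product:
  "restricted_overpartitions_fps k * (\<Prod>i<k. 1 - fps_X ^ Suc i) = (\<Prod>i<k. 1 + fps_X ^ Suc i)"
proof (induction k)
  case 0
  then show ?case by (intro fps_ext) (simp add: restricted_overpartitions_fps_def restricted_overpartitions_0)
next
  case (Suc k)
  have "restricted_overpartitions_fps (Suc k) * (\<Prod>i<Suc k. 1 - fps_X ^ Suc i) =
      (restricted_overpartitions_fps (Suc k) * (1 - fps_X ^ Suc k)) * (\<Prod>i<k. 1 - fps_X ^ Suc i)"
    by (simp only: prod.lessThan_Suc mult_ac)
  also have "\<dots> = (1 + fps_X ^ Suc k) * (restricted_overpartitions_fps k * (\<Prod>i<k. 1 - fps_X ^ Suc i))"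
    by (simp only: restricted_overpartitions_fps_Suc mult_ac)
  finally show ?case unfolding Suc by (simp only: prod.lessThan_Suc mult_ac)
qed

section \<open>Gaussian binomial coefficients\<close>

fun qbinomial :: "'a::comm_ring_1 \<Rightarrow> nat \<Rightarrow> nat \<Rightarrow> 'a" where
  "qbinomial q n 0 = 1"
| "qbinomial q 0 (Suc k) = 0"
| "qbinomial q (Suc n) (Suc k) = qbinomial q n k + q ^ Suc k * qbinomial q n (Suc k)"

definition qfact :: "'a::comm_ring_1 \<Rightarrow> nat \<Rightarrow> 'a" where
  "qfact q n = (\<Prod>i<n. 1 - q ^ Suc i)"

lemma qfact_Suc: "qfact q (Suc n) = qfact q n * (1 - q ^ Suc n)"
  by (simp add: qfact_def)

lemma qbinomial_eq_0: "n < k \<Longrightarrow> qbinomial q n k = 0"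
  by (induction q n k rule: qbinomial.induct) auto

text \<open>The quotient formula in multiplied form, since the Pascal recursion defines
  \<open>qbinomial\<close> over any commutative ring, where \<open>qfact\<close> may fail to be
  invertible.\<close>

lemma qbinomial_qfact: "k \<le> n \<Longrightarrow> qbinomial q n k * qfact q k * qfact q (n - k) = qfact q n"
proof (induction q n k rule: qbinomial.induct)
  case (3 q n k)
  have k: "k \<le> n" using 3 by simp
  have 1: "qbinomial q n k * qfact q k * qfact q (n - k) = qfact q n" using 3 by simp
  have 2: "qbinomial q n (Suc k) * qfact q (Suc k) * qfact q (n - k) = qfact q n * (1 - q ^ (n - k))"
  proof (cases "k = n")
    case True
    then show ?thesis by (simp add: qbinomial_eq_0)
  next
    case False
    then have "n - k = Suc (n - Suc k)" using k by simp
    then have "qfact q (n - k) = qfact q (n - Suc k) * (1 - q ^ (n - k))" by (metis qfact_Suc)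
    then show ?thesis using 3(2) False k by (simp add: mult.assoc[symmetric])
  qed
  have q: "q ^ Suc k * q ^ (n - k) = q ^ Suc n" using k by (metis add_Suc le_add_diff_inverse power_add)
  have "qbinomial q (Suc n) (Suc k) * qfact q (Suc k) * qfact q (Suc n - Suc k) =
      (qbinomial q n k * qfact q k * qfact q (n - k)) * (1 - q ^ Suc k) +
      q ^ Suc k * (qbinomial q n (Suc k) * qfact q (Suc k) * qfact q (n - k))"
    by (simp add: qfact_Suc algebra_simps)
  also have "\<dots> = qfact q n * (1 - q ^ Suc k * q ^ (n - k))"
    unfolding 1 2 by (simp add: algebra_simps)
  finally show ?case unfolding q qfact_Suc .
qed (simp_all add: qfact_def)

lemma qbinomial_theorem:
  "(\<Prod>k<n. x + y * q ^ k) = (\<Sum>m\<le>n. q ^ (m choose 2) * qbinomial q n m * y ^ m * x ^ (n - m))"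
proof (induction n arbitrary: y)
  case 0
  then show ?case by (simp add: numeral_2_eq_2)
next
  case (Suc n)
  define t where "t = (\<lambda>m. q ^ (m choose 2) * q ^ m * qbinomial q n m * y ^ m)"
  have ch: "Suc m choose 2 = (m choose 2) + m" for m by (simp add: numeral_2_eq_2)
  have "(\<Prod>k<Suc n. x + y * q ^ k) = (x + y) * (\<Prod>k<n. x + (y * q) * q ^ k)"
    by (simp add: prod.lessThan_Suc_shift mult.assoc del: prod.lessThan_Suc)
  also have "(\<Prod>k<n. x + (y * q) * q ^ k) = (\<Sum>m\<le>n. t m * x ^ (n - m))"
    unfolding Suc t_def by (intro sum.cong refl) (simp add: power_mult_distrib mult_ac)
  also have "(x + y) * \<dots> = x * (\<Sum>m\<le>n. t m * x ^ (n - m)) + y * (\<Sum>m\<le>n. t m * x ^ (n - m))"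
    by (rule distrib_right)
  also have "\<dots> = (\<Sum>m\<le>n. t m * x ^ (Suc n - m)) + (\<Sum>m\<le>n. t m * y * x ^ (Suc n - Suc m))"
    unfolding sum_distrib_left
    by (intro arg_cong2[of _ _ _ _ "(+)"] sum.cong refl) (simp_all add: Suc_diff_le mult_ac)
  \<comment> \<open>The added term is 0, because \<open>qbinomial q n (Suc n) = 0\<close>; shifting
    the index then allows Pascal's rule.\<close>
  also have "(\<Sum>m\<le>n. t m * x ^ (Suc n - m)) = (\<Sum>m\<le>Suc n. t m * x ^ (Suc n - m))"
    by (simp add: t_def qbinomial_eq_0)
  also have "\<dots> = x ^ Suc n + (\<Sum>m\<le>n. t (Suc m) * x ^ (Suc n - Suc m))"
    by (subst sum.atMost_Suc_shift) (simp add: t_def numeral_2_eq_2)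
  also have "\<dots> + (\<Sum>m\<le>n. t m * y * x ^ (Suc n - Suc m)) =
      x ^ Suc n + (\<Sum>m\<le>n. (t (Suc m) + t m * y) * x ^ (Suc n - Suc m))"
    by (simp add: sum.distrib distrib_right)
  also have "(\<Sum>m\<le>n. (t (Suc m) + t m * y) * x ^ (Suc n - Suc m)) =
      (\<Sum>m\<le>n. q ^ (Suc m choose 2) * qbinomial q (Suc n) (Suc m) * y ^ Suc m * x ^ (Suc n - Suc m))"
    by (intro sum.cong refl arg_cong2[of _ _ _ _ "(*)"])
      (simp add: t_def ch power_add algebra_simps)
  also have "x ^ Suc n + \<dots> = (\<Sum>m\<le>Suc n. q ^ (m choose 2) * qbinomial q (Suc n) m * y ^ m * x ^ (Suc n - m))"
    by (subst sum.atMost_Suc_shift) (simp add: numeral_2_eq_2)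
  finally show ?case .
qed

section \<open>Gauss's product for the theta series\<close>

text \<open>A finite form of Jacobi's triple product: the q-binomial theorem with
  \<open>2 * n\<close> factors, base \<open>X\<^sup>2\<close> and \<open>y = -1\<close>. The value
  \<open>x = X ^ (2 * n - 1)\<close> completes the square, giving the exponent
  \<open>(m - n)\<^sup>2 + e\<close>; the factors \<open>X ^ e\<close> and \<open>(-1) ^ n\<close>
  occur on both sides and cancel.\<close>

lemma finite_theta_product:
  assumes n: "n > 0"
  shows "(\<Sum>m\<le>2 * n. (-1) ^ (n + m) * fps_X ^ (nat \<bar>int m - int n\<bar>)\<^sup>2 * qbinomial (fps_X\<^sup>2) (2 * n) m) =
    (\<Prod>i<n. 1 - fps_X ^ (2 * i + 1) :: int fps)\<^sup>2"
proof -
  define e where "e = n * (n - 1) + n * (2 * n - 1)"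
  define O' where "O' = (\<Prod>i<n. 1 - fps_X ^ (2 * i + 1) :: int fps)"
  define x where "x = (fps_X ^ (2 * n - 1) :: int fps)"
  define q where "q = (fps_X\<^sup>2 :: int fps)"
  have split: "(\<Prod>k<2 * n. f k) = (\<Prod>k<n. f k) * (\<Prod>k<n. f (n + k))" for f :: "nat \<Rightarrow> int fps"
  proof -
    have "(\<Prod>k<a + b. f k) = (\<Prod>k<a. f k) * (\<Prod>k<b. f (a + k))" for a b
      by (induction b) (simp_all add: mult.assoc)
    then show ?thesis by (simp add: mult_2)
  qed
  have low: "(\<Prod>k<n. x + (-1) * q ^ k) = (-1) ^ n * fps_X ^ (n * (n - 1)) * O'"
  proof -
    have "(\<Prod>k<n. x + (-1) * q ^ k) = (\<Prod>k<n. (-1) * fps_X ^ (2 * k) * (1 - fps_X ^ (2 * (n - Suc k) + 1)))"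
    proof (intro prod.cong refl)
      fix k assume "k \<in> {..<n}"
      then have "2 * n - 1 = 2 * k + (2 * (n - Suc k) + 1)" by auto
      then have "x = fps_X ^ (2 * k) * fps_X ^ (2 * (n - Suc k) + 1)"
        unfolding x_def by (simp only: power_add)
      then show "x + (-1) * q ^ k = (-1) * fps_X ^ (2 * k) * (1 - fps_X ^ (2 * (n - Suc k) + 1))"
        by (simp only: q_def power_mult[symmetric]) (simp add: algebra_simps)
    qed
    also have "\<dots> = (\<Prod>k<n. (-1)) * (\<Prod>k<n. fps_X ^ (2 * k)) * (\<Prod>k<n. 1 - fps_X ^ (2 * (n - Suc k) + 1))"
      by (simp only: prod.distrib)
    also have "(\<Prod>k<n. fps_X ^ (2 * k)) = (fps_X ^ (n * (n - 1)) :: int fps)"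
    proof -
      have "(\<Sum>k<n. 2 * k) = n * (n - 1)" by (induction n) (auto simp: algebra_simps)
      then show ?thesis by (simp flip: power_sum)
    qed
    also have "(\<Prod>k<n. 1 - fps_X ^ (2 * (n - Suc k) + 1)) = O'"
      unfolding O'_def by (rule prod.nat_diff_reindex)
    finally show ?thesis by simp
  qed
  have high: "(\<Prod>k<n. x + (-1) * q ^ (n + k)) = fps_X ^ (n * (2 * n - 1)) * O'"
  proof -
    have "x + (-1) * q ^ (n + k) = x * (1 - fps_X ^ (2 * k + 1))" for k
    proof -
      have "2 * (n + k) = (2 * n - 1) + (2 * k + 1)" using n by simp
      then have "q ^ (n + k) = x * fps_X ^ (2 * k + 1)"
        unfolding q_def x_def power_mult[symmetric] power_add[symmetric] by (simp only:)
      then show ?thesis by (simp add: algebra_simps)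
    qed
    then have "(\<Prod>k<n. x + (-1) * q ^ (n + k)) = (\<Prod>k<n. x) * O'"
      by (simp only: O'_def prod.distrib)
    then show ?thesis by (simp add: x_def mult.commute flip: power_mult)
  qed
  have summand: "q ^ (m choose 2) * qbinomial q (2 * n) m * (-1) ^ m * x ^ (2 * n - m) =
      (-1) ^ n * fps_X ^ e * ((-1) ^ (n + m) * fps_X ^ (nat \<bar>int m - int n\<bar>)\<^sup>2 * qbinomial q (2 * n) m)"
    if m: "m \<le> 2 * n" for m
  proof -
    have "int (2 * (m choose 2) + (2 * n - 1) * (2 * n - m)) = int (e + (nat \<bar>int m - int n\<bar>)\<^sup>2)"
    proof -
      have "even (m * (m - 1))" by (cases m) simp_all
      then have "2 * (m choose 2) = m * (m - 1)" by (simp add: choose_two)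
      then have "int (2 * (m choose 2)) = int m * (int m - 1)" by (cases m) (auto simp: algebra_simps)
      moreover have "int (2 * n - m) = 2 * int n - int m" using m by simp
      moreover have "int (2 * n - 1) = 2 * int n - 1" "int (n - 1) = int n - 1" using n by auto
      ultimately show ?thesis
        unfolding e_def of_nat_add of_nat_mult of_nat_power by (simp add: power2_eq_square algebra_simps)
    qed
    then have "2 * (m choose 2) + (2 * n - 1) * (2 * n - m) = e + (nat \<bar>int m - int n\<bar>)\<^sup>2"
      by (simp only: of_nat_eq_iff)
    then have pow: "q ^ (m choose 2) * x ^ (2 * n - m) = fps_X ^ e * fps_X ^ (nat \<bar>int m - int n\<bar>)\<^sup>2"
      unfolding q_def x_def power_mult[symmetric] by (simp only: power_add[symmetric])
    have sign: "(-1) ^ m = (-1) ^ n * ((-1) ^ (n + m) :: int fps)"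
      by (simp add: power_add)
    have "q ^ (m choose 2) * qbinomial q (2 * n) m * (-1) ^ m * x ^ (2 * n - m) =
        (-1) ^ m * (q ^ (m choose 2) * x ^ (2 * n - m)) * qbinomial q (2 * n) m"
      by (simp only: mult_ac)
    then show ?thesis unfolding pow unfolding sign by (simp only: mult_ac)
  qed
  have "(-1) ^ n * fps_X ^ e * O'\<^sup>2 = (\<Prod>k<2 * n. x + (-1) * q ^ k)"
    unfolding split low high e_def by (simp add: power_add power2_eq_square mult_ac)
  also have "\<dots> = (\<Sum>m\<le>2 * n. q ^ (m choose 2) * qbinomial q (2 * n) m * (-1) ^ m * x ^ (2 * n - m))"
    by (rule qbinomial_theorem)
  also have "\<dots> = (-1) ^ n * fps_X ^ e * (\<Sum>m\<le>2 * n. (-1) ^ (n + m) * fps_X ^ (nat \<bar>int m - int n\<bar>)\<^sup>2 * qbinomial q (2 * n) m)"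
    unfolding sum_distrib_left by (intro sum.cong refl summand) simp
  finally show ?thesis by (simp add: O'_def q_def)
qed

section \<open>Equality modulo \<open>q ^ (N + 1)\<close>, in place of infinite products\<close>

definition fps_agree :: "nat \<Rightarrow> int fps \<Rightarrow> int fps \<Rightarrow> bool" where
  "fps_agree N f g \<longleftrightarrow> (\<forall>i\<le>N. f $ i = g $ i)"

lemma fps_agree_refl [simp, intro]: "fps_agree N f f"
  by (simp add: fps_agree_def)

lemma fps_agree_sym: "fps_agree N f g \<Longrightarrow> fps_agree N g f"
  by (simp add: fps_agree_def)

lemma fps_agree_trans [trans]: "fps_agree N f g \<Longrightarrow> fps_agree N g h \<Longrightarrow> fps_agree N f h"
  by (simp add: fps_agree_def)

lemma fps_agree_mult: "fps_agree N f g \<Longrightarrow> fps_agree N f' g' \<Longrightarrow> fps_agree N (f * f') (g * g')"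
  by (auto simp: fps_agree_def fps_mult_nth intro!: sum.cong)

lemma fps_agree_sum: "(\<And>i. i \<in> S \<Longrightarrow> fps_agree N (f i) (g i)) \<Longrightarrow> fps_agree N (sum f S) (sum g S)"
  by (auto simp: fps_agree_def fps_sum_nth intro!: sum.cong)

lemma fps_agree_cancel:
  assumes h: "h $ 0 = 1" and fg: "fps_agree N (h * f) (h * g)"
  shows "fps_agree N f g"
proof -
  have "i \<le> N \<longrightarrow> f $ i = g $ i" for i
  proof (induction i rule: less_induct)
    case (less i)
    have expand: "(h * f) $ i = f $ i + (\<Sum>k\<in>{0<..i}. h $ k * f $ (i - k))" for f :: "int fps"
    proof -
      have "{0..i} = insert 0 {0<..i}" by auto
      then show ?thesis by (simp add: fps_mult_nth h)
    qed
    show ?case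
    proof
      assume "i \<le> N"
      then have "(\<Sum>k\<in>{0<..i}. h $ k * f $ (i - k)) = (\<Sum>k\<in>{0<..i}. h $ k * g $ (i - k))"
        using less by (intro sum.cong refl) auto
      moreover have "(h * f) $ i = (h * g) $ i" using fg \<open>i \<le> N\<close> by (simp add: fps_agree_def)
      ultimately show "f $ i = g $ i" by (simp add: expand)
    qed
  qed
  then show ?thesis by (simp add: fps_agree_def)
qed

lemma fps_agree_X_power_mult: "N < k \<Longrightarrow> fps_agree N (fps_X ^ k * f) 0"
  by (simp add: fps_agree_def fps_X_power_mult_nth)

lemma qfact_X2_nth_0: "qfact (fps_X\<^sup>2 :: int fps) n $ 0 = 1"
  by (induction n) (simp_all add: qfact_Suc, simp add: qfact_def)

lemma fps_agree_qfact:
  assumes "N \<le> m" "m \<le> n"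
  shows "fps_agree N (qfact (fps_X\<^sup>2) n) (qfact (fps_X\<^sup>2) m)"
  using assms(2)
proof (induction rule: dec_induct)
  case (step n)
  have "N < 2 * Suc n" using step assms by simp
  then have "fps_agree N (fps_X ^ (2 * Suc n) * qfact (fps_X\<^sup>2) n) 0" by (rule fps_agree_X_power_mult)
  moreover have "qfact (fps_X\<^sup>2) (Suc n) = qfact (fps_X\<^sup>2) n - fps_X ^ (2 * Suc n) * qfact (fps_X\<^sup>2 :: int fps) n"
    unfolding qfact_Suc power_mult[symmetric] by (simp only: right_diff_distrib mult_1_left mult_1_right mult.commute)
  ultimately have "fps_agree N (qfact (fps_X\<^sup>2) (Suc n)) (qfact (fps_X\<^sup>2) n)"
    by (simp only: fps_agree_def fps_sub_nth fps_zero_nth) simp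
  then show ?case using step.IH by (rule fps_agree_trans)
qed simp

text \<open>When \<open>m\<close> and \<open>k - m\<close> are both at least \<open>N\<close>, all
  three q-factorials agree with \<open>qfact (fps_X\<^sup>2) N\<close> to the required order, and
  one of them cancels.\<close>

lemma fps_agree_qbinomial:
  assumes "N \<le> m" "m + N \<le> k"
  shows "fps_agree N (qbinomial (fps_X\<^sup>2) k m * qfact (fps_X\<^sup>2) N) 1"
proof -
  let ?q = "fps_X\<^sup>2 :: int fps"
  have "fps_agree N (qbinomial ?q k m * qfact ?q N * qfact ?q N) (qbinomial ?q k m * qfact ?q m * qfact ?q (k - m))"
    using assms by (intro fps_agree_mult fps_agree_refl fps_agree_sym[OF fps_agree_qfact]) auto
  also have "\<dots> = qfact ?q k" using assms by (intro qbinomial_qfact) simp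
  also have "fps_agree N \<dots> (qfact ?q N)" using assms by (intro fps_agree_qfact) simp_all
  finally have "fps_agree N (qfact ?q N * (qbinomial ?q k m * qfact ?q N)) (qfact ?q N * 1)"
    by (simp add: mult_ac)
  then show ?thesis by (rule fps_agree_cancel[rotated]) (rule qfact_X2_nth_0)
qed

lemma neg_one_power_mult_X_power_nth:
  "((-1) ^ a * fps_X ^ e) $ i = (if i = e then (-1) ^ a else (0 :: int))"
  by (induction a) simp_all

lemma fps_agree_theta_alt:
  assumes "N \<le> n"
  shows "fps_agree N (\<Sum>m\<le>2 * n. (-1) ^ (n + m) * fps_X ^ (nat \<bar>int m - int n\<bar>)\<^sup>2) theta_alt"
  unfolding fps_agree_def
proof (intro allI impI)
  fix i assume i: "i \<le> N"
  have "(\<Sum>m\<le>2 * n. (-1) ^ (n + m) * fps_X ^ (nat \<bar>int m - int n\<bar>)\<^sup>2) $ i =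
      (\<Sum>m\<le>2 * n. if int i = (int m - int n)\<^sup>2 then (-1) ^ (n + m) else (0 :: int))"
    unfolding fps_sum_nth
  proof (intro sum.cong refl)
    fix m
    have "i = (nat \<bar>int m - int n\<bar>)\<^sup>2 \<longleftrightarrow> int i = (int m - int n)\<^sup>2"
    proof -
      have "int ((nat \<bar>int m - int n\<bar>)\<^sup>2) = (int m - int n)\<^sup>2" by simp
      then show ?thesis by (metis of_nat_eq_iff)
    qed
    then show "((-1) ^ (n + m) * fps_X ^ (nat \<bar>int m - int n\<bar>)\<^sup>2) $ i = (if int i = (int m - int n)\<^sup>2 then (-1) ^ (n + m) else (0 :: int))"
      by (simp only: neg_one_power_mult_X_power_nth)
  qed
  also have "\<dots> = (\<Sum>m | m \<le> 2 * n \<and> int i = (int m - int n)\<^sup>2. (-1) ^ (n + m))"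
    by (simp add: sum.If_cases Collect_conj_eq atMost_def)
  also have "\<dots> = (\<Sum>y\<in>sq_roots i. if even y then 1 else -1)"
  proof (rule sum.reindex_bij_witness[of _ "\<lambda>y. nat (y + int n)" "\<lambda>m. int m - int n"])
    fix y assume y: "y \<in> sq_roots i"
    then have "\<bar>y\<bar>\<^sup>2 = int i" by (simp add: sq_roots_def)
    moreover have "\<bar>y\<bar> \<le> \<bar>y\<bar>\<^sup>2" using self_le_power[of "\<bar>y\<bar>" 2] by (cases "y = 0") auto
    ultimately have "\<bar>y\<bar> \<le> int n" using i assms by linarith
    then show "int (nat (y + int n)) - int n = y"
      "nat (y + int n) \<in> {m. m \<le> 2 * n \<and> int i = (int m - int n)\<^sup>2}"
      using y by (auto simp: sq_roots_def)
  next
    fix m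
    have "even (int m - int n) \<longleftrightarrow> even (n + m)" by (metis even_add even_diff even_of_nat add.commute)
    then show "(if even (int m - int n) then 1 else -1) = (-1 :: int) ^ (n + m)" by simp
  qed (auto simp: sq_roots_def)
  also have "\<dots> = theta_alt $ i" by (simp add: theta_alt_conv_weighted)
  finally show "(\<Sum>m\<le>2 * n. (-1) ^ (n + m) * fps_X ^ (nat \<bar>int m - int n\<bar>)\<^sup>2) $ i = theta_alt $ i" .
qed

text \<open>With \<open>n = 2 * N + 1\<close>, every \<open>m\<close> within \<open>N\<close> of
  \<open>n\<close> satisfies \<open>N \<le> m\<close> and \<open>m + N \<le> 2 * n\<close>, so its
  Gaussian binomial stabilizes; all other terms have order above \<open>N\<close>.\<close>

lemma fps_agree_theta_alt_product:
  fixes N :: nat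
  defines "n \<equiv> Suc (2 * N)"
  shows "fps_agree N theta_alt ((\<Prod>i<n. 1 - fps_X ^ (2 * i + 1))\<^sup>2 * qfact (fps_X\<^sup>2) N)"
proof -
  define s where "s = (\<lambda>m. (-1) ^ (n + m) * fps_X ^ (nat \<bar>int m - int n\<bar>)\<^sup>2 :: int fps)"
  have "fps_agree N theta_alt (\<Sum>m\<le>2 * n. s m)"
    unfolding s_def by (rule fps_agree_sym, rule fps_agree_theta_alt) (simp add: n_def)
  also have "fps_agree N \<dots> (\<Sum>m\<le>2 * n. s m * (qbinomial (fps_X\<^sup>2) (2 * n) m * qfact (fps_X\<^sup>2) N))"
  proof (intro fps_agree_sum)
    fix m assume m: "m \<in> {..2 * n}"
    show "fps_agree N (s m) (s m * (qbinomial (fps_X\<^sup>2) (2 * n) m * qfact (fps_X\<^sup>2) N))"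
    proof (cases "nat \<bar>int m - int n\<bar> \<le> N")
      case True
      have "fps_agree N (s m * 1) (s m * (qbinomial (fps_X\<^sup>2) (2 * n) m * qfact (fps_X\<^sup>2) N))"
        using True by (intro fps_agree_mult fps_agree_refl fps_agree_sym[OF fps_agree_qbinomial]) (auto simp: n_def)
      then show ?thesis by simp
    next
      case False
      then have "N < (nat \<bar>int m - int n\<bar>)\<^sup>2"
        by (meson linorder_not_le less_le_trans self_le_power zero_less_numeral le_trans Suc_leI le_eq_less_or_eq power2_nat_le_imp_le)
      then have 0: "fps_agree N (s m * f) 0" for f
      proof -
        have "s m * f = fps_X ^ (nat \<bar>int m - int n\<bar>)\<^sup>2 * ((-1) ^ (n + m) * f)"
          by (simp only: s_def mult_ac)
        then show ?thesis using fps_agree_X_power_mult[OF \<open>N < _\<close>] by (simp only:)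
      qed
      show ?thesis using 0[of 1] fps_agree_sym[OF 0] by (metis fps_agree_trans mult_1_right)
    qed
  qed
  also have "(\<Sum>m\<le>2 * n. s m * (qbinomial (fps_X\<^sup>2) (2 * n) m * qfact (fps_X\<^sup>2) N)) =
      (\<Sum>m\<le>2 * n. s m * qbinomial (fps_X\<^sup>2) (2 * n) m) * qfact (fps_X\<^sup>2) N"
    by (simp add: sum_distrib_right mult.assoc)
  also have "(\<Sum>m\<le>2 * n. s m * qbinomial (fps_X\<^sup>2) (2 * n) m) = (\<Prod>i<n. 1 - fps_X ^ (2 * i + 1))\<^sup>2"
    unfolding s_def by (rule finite_theta_product) (simp add: n_def)
  finally show ?thesis .
qed

definition overpartition_fps :: "int fps" where
  "overpartition_fps = Abs_fps (\<lambda>n. int (overpartition_count n))"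

text \<open>To each order \<open>N\<close>, \<open>C * D = S\<close>,
  \<open>S * D = R (2 * n)\<close> and the splitting \<open>D = O' * R n\<close> into odd and even
  factors reduce both sides to \<open>D * D\<close>, which cancels.\<close>

lemma overpartition_fps_mult_theta_alt: "overpartition_fps * theta_alt = 1"
proof -
  have "fps_agree N (overpartition_fps * theta_alt) 1" for N
  proof -
    define n where "n = Suc (2 * N)"
    define D S O' R where "D = (\<Prod>i<2 * n. 1 - fps_X ^ Suc i :: int fps)"
      and "S = (\<Prod>i<2 * n. 1 + fps_X ^ Suc i :: int fps)"
      and "O' = (\<Prod>i<n. 1 - fps_X ^ (2 * i + 1) :: int fps)"
      and "R = qfact (fps_X\<^sup>2 :: int fps)"
    define C where "C = restricted_overpartitions_fps (2 * n)"
    have CD: "C * D = S" unfolding C_def D_def S_def by (rule restricted_overpartitions_fps_product)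
    have SD: "S * D = R (2 * n)"
      unfolding S_def D_def R_def qfact_def prod.distrib[symmetric]
      by (intro prod.cong refl) (simp add: algebra_simps power2_eq_square power_mult_distrib)
    have D: "D = O' * R n"
    proof -
      have "(\<Prod>i<2 * n. g i) = (\<Prod>i<n. g (2 * i)) * (\<Prod>i<n. g (2 * i + 1))" for g :: "nat \<Rightarrow> int fps" and n
        by (induction n) (simp_all add: mult_ac)
      then show ?thesis
        unfolding D_def O'_def R_def qfact_def power_mult[symmetric] by simp
    qed
    have D0: "D $ 0 = 1"
      unfolding D_def by (induction n) simp_all
    have agree_P: "fps_agree N overpartition_fps C"
      by (simp add: fps_agree_def overpartition_fps_def C_def restricted_overpartitions_fps_def n_def
          restricted_overpartitions_eq_overpartitions overpartition_count_def)
    have agree_R: "fps_agree N (R m) (R N)" if "N \<le> m" for m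
      unfolding R_def by (rule fps_agree_qfact) (use that in auto)
    have "fps_agree N (D * D * (overpartition_fps * theta_alt)) (D * D * (C * (O'\<^sup>2 * R N)))"
      unfolding O'_def R_def n_def
      by (intro fps_agree_mult fps_agree_refl agree_P fps_agree_theta_alt_product)
    also have "D * D * (C * (O'\<^sup>2 * R N)) = O'\<^sup>2 * R N * R (2 * n)"
      unfolding SD[symmetric] CD[symmetric] by (simp add: mult_ac)
    also have "fps_agree N \<dots> (O'\<^sup>2 * R n * R n)"
      by (intro fps_agree_mult fps_agree_refl fps_agree_trans[OF agree_R fps_agree_sym[OF agree_R]]) (auto simp: n_def)
    also have "O'\<^sup>2 * R n * R n = D * D * 1"
      unfolding D by (simp add: power2_eq_square mult_ac)
    finally show ?thesis by (rule fps_agree_cancel[rotated]) (simp add: D0)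
  qed
  then show ?thesis unfolding fps_agree_def by (intro fps_ext) blast
qed

theorem mainTheorem1:
  fixes n :: nat
  shows "overpartition_count (11 * (8 * n + 5)) mod 11 = 0 \<and>
         overpartition_count (13 * 2^6 * (8 * n + 7)) mod 13 = 0"
proof -
  \<comment> \<open>The change \<open>q |-> -q\<close> replaces \<open>theta_alt\<close> by
    \<open>theta\<close> and alters coefficients only by signs, which do not affect
    divisibility.\<close>
  define P where "P = overpartition_fps oo (- fps_X)"
  have P: "P * theta = 1"
  proof -
    have "(overpartition_fps * theta_alt) oo (- fps_X) = P * theta"
      by (simp add: P_def fps_compose_mult_distrib theta_alt_compose_neg_X)
    then show ?thesis by (simp add: overpartition_fps_mult_theta_alt)
  qed
  have nth: "k dvd P $ m \<longleftrightarrow> k dvd int (overpartition_count m)" for k m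
    by (cases "even m") (simp_all add: P_def fps_compose_neg_X_nth overpartition_fps_def)
  have "int 11 dvd int (overpartition_count (11 * (8 * n + 5)))"
    using dvd_nth_inverse_theta_11[OF P, of n] by (simp only: nth of_nat_numeral)
  moreover have "int 13 dvd int (overpartition_count (13 * (4 * (4 * (4 * (8 * n + 7))))))"
    using dvd_nth_inverse_theta_13[OF P, of n] by (simp only: nth of_nat_numeral)
  moreover have "13 * (4 * (4 * (4 * (8 * n + 7)))) = 13 * 2 ^ 6 * (8 * n + 7)" by simp
  ultimately show ?thesis
    unfolding int_dvd_int_iff by (simp only: dvd_eq_mod_eq_0)
qed

end
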